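(* Let $K$ be a knot type, $u\in\mathbb S^2$, and let $(\Gamma_i,B_i,\tau_i)$, $1\le i\le k$, be a separated system of local moves on a $C^{1,1}$ embedded representative $\gamma_0$ of $K$ with $\operatorname{Thi}(\gamma_0)\ge1$ and regular projection in direction $u$. Set $$\Lambda_{\mathrm{cube}}=\operatorname{Len}(\gamma_0)+\sum_{i=1}^k\delta_i,\qquad\delta_i=\max\Bigl\{0,\ \sup_{t\in[0,1]}\operatorname{Len}(\Gamma_i(t))-\operatorname{Len}(\gamma_0)\Bigr\}.$$ Then every composite state $\gamma_S$ and every intermediate composite curve is an embedded $C^{1,1}$ representative of $K$ with thickness at least $1$ and length, hence ropelength, at most $\Lambda_{\mathrm{cube}}$, and every composite movie is an admissible projection-generic movie in $\mathcal X_{\Lambda_{\mathrm{cube}},u}(K)$ crossing exactly one wall, transversely and of the expected type (type $\tau_i$ for the movie performing move $i$). Consequently all diagrams $D_S$, $S\subseteq\{1,\dots,k\}$, and all transitions $D_S\to D_{S\cup\{i\}}$, $i\notin S$, are visible in (belong to) $\mathcal H_{\Lambda_{\mathrm{cube}},u}(K)$; and if the $2^k$ diagrams $D_S$ are pairwise distinct, the typed $k$-cube they span in $G_S(K)$ has a vertex-coherent lift at level $\Lambda_{\mathrm{cube}}$, with the fiber component of $\gamma_S$ at each vertex.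
   Context: **Thickness and ropelength.** Knot types are unoriented tame knot types. For a $C^{1,1}$ embedded closed curve $\gamma\subset\mathbb R^3$, its thickness $\operatorname{Thi}(\gamma)$ is its reach in the sense of Federer, and for positive thickness $\operatorname{Rop}(\gamma)=\operatorname{Len}(\gamma)/\operatorname{Thi}(\gamma)$. **Sublevel space.** Fix $u\in\mathbb S^2$. $\operatorname{Sim}_u^+(\mathbb R^3)$ is the group of orientation-preserving Euclidean similarities whose rotational part fixes $u$. $\mathcal E(K)$ is the space of positive-thickness $C^{1,1}$ embedded closed curves representing $K$, with the strong $C^{1,1}$ topology in local normal-graph charts, and $\mathcal X_{\Lambda,u}(K)=\{\gamma\in\mathcal E(K)\mid\operatorname{Rop}(\gamma)\le\Lambda\}/\operatorname{Sim}_u^+(\mathbb R^3)$. An admissible isotopy (movie) is a (piecewise, after finite subdivision of time) jointly $C^{1,1}$ map $\Gamma:S^1\times[0,1]\to\mathbb R^3$ whose time slices are positive-thickness $C^{1,1}$ embeddings of type $K$, with $|\partial_s\Gamma|$ bounded away from zero; it is $\Lambda$-admissible if $\operatorname{Rop}(\Gamma_t)\le\Lambda$ for all $t$. **Projections.** $p_u:\mathbb R^3\to u^\perp$ is orthogonal projection. The projection of $\gamma$ is regular if it has only finitely many transverse double points and no triple point, tangency or cusp; the image with over/under information is the diagram $\Pi_u(\gamma)$, considered on $S^2=u^\perp\cup\{\infty\}$ up to orientation-preserving isotopy. A curve lies on a Reidemeister wall if its projection has exactly one standard generic codimension-one singularity and is otherwise regular: a cusp (type $R1$), a self-tangency of two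 branches (type $R2$), or a transverse triple point (type $R3$). An admissible path is projection-generic if its projection is regular except at finitely many times, at each of which it crosses exactly one Reidemeister wall transversely (all other singularities being avoided). Projection-genericity is considered for sufficiently regular paths. **Graphs.** $G_S(K)$ has as vertices the diagrams of $K$ on $S^2$ up to orientation-preserving isotopy of $S^2$; its edges are equivalence classes of single Reidemeister moves, moves coinciding under diagram isotopy defining the same edge, and distinct moves with the same endpoints remaining distinct parallel edges. For a diagram $D$, fiber components are the path components of $F_{\Lambda,u}(D)=\{x\in\mathcal X_{\Lambda,u}(K)\mid\Pi_u(x)=D\}$. $\mathcal G^{\mathrm{lift}}_{\Lambda,u}(K)$ has vertices $(D,F)$ with $F$ a fiber component over $D$, and for each edge $e:D\to D'$ of $G_S(K)$ one edge $(e,F,F')$ precisely when some $\Lambda$-admissible projection-generic movie realizes $e$ from a point of $F$ to a point of $F'$. $\mathcal H_{\Lambda,u}(K)\subset G_S(K)$ is its image under $(D,F)\mapsto D$, $(e,F,F')\mapsto e$. A vertex-coherent lift at level $\Lambda$ of a finite submultigraph $Q\subset G_S(K)$ with specified edges is a choice of one vertex $(D,F_D)$ of $\mathcal G^{\mathrm{lift}}_{\Lambda,u}(K)$ for each vertex $D$ of $Q$ such that every specified edge $e:D\to D'$ of $Q$ lifts to an edge $(e,F_D,F_{D'})$. **Separated systems.** Let $\gamma_0$ be a $C^{1,1}$ embedded representative of $K$ with $\operatorname{Thi}(\gamma_0)\ge1$ whose projection in direction $u$ is regular, with diagram $D_0$. A separated system of local moves on $\gamma_0$ is a finite collection $(\Gamma_i,B_i,\tau_i)$,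 $1\le i\le k$, where each $B_i\subset\mathbb R^3$ is a closed ball, each $\tau_i\in\{R1,R2,R3\}$, and each $\Gamma_i(t)$, $0\le t\le1$, is a movie of embedded $C^{1,1}$ curves of thickness at least $1$ starting at $\gamma_0$, stationary outside $B_i$, whose projected movie crosses exactly one Reidemeister wall, transversely and of type $\tau_i$, and is otherwise regular, such that $\operatorname{dist}(B_i,B_j)\ge2$ for all $i\ne j$ and the disks $p_u(B_1),\dots,p_u(B_k)\subset u^\perp$ are pairwise disjoint. For $S\subseteq\{1,\dots,k\}$, the composite state $\gamma_S$ agrees with $\Gamma_i(1)$ inside $B_i$ for $i\in S$ and with $\gamma_0$ elsewhere, and $D_S=\Pi_u(\gamma_S)$. The composite movie performing move $i\notin S$ from $\gamma_S$ is obtained from $\gamma_{S\cup\{i\}}$ by replacing $\Gamma_i(1)$ by $\Gamma_i(t)$ inside $B_i$, $0\le t\le1$; its time slices are the intermediate composite curves. *)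

theory Defs
  imports "HOL-Analysis.Analysis" "Graph_Theory.Digraph_Component"
begin

section \<open>Curves, thickness, ropelength\<close>

text \<open>
  The circle is \<open>\<real>/\<int>\<close>: a closed curve is a 1-periodic function on the reals, and
  \<open>{0..<1}\<close> is a fundamental domain. Unparametrized curves are the images.
\<close>

type_synonym curve = "real \<Rightarrow> real^3"
type_synonym movie = "real \<Rightarrow> curve"  \<comment> \<open>time first, then the parameter on the circle\<close>

definition velocity :: "(real \<Rightarrow> 'a::real_normed_vector) \<Rightarrow> real \<Rightarrow> 'a" where
  "velocity c s = vector_derivative c (at s)"

definition C11_on :: "'a::real_normed_vector set \<Rightarrow> ('a \<Rightarrow> 'b::real_normed_vector) \<Rightarrow> bool" where
  "C11_on S f \<longleftrightarrow> (\<exists>f' L. (\<forall>x\<in>S. (f has_derivative blinfun_apply (f' x)) (at x within S))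
                         \<and> L-lipschitz_on S f')"

text \<open>\<open>k\<close>-fold continuous differentiability on an open set.\<close>

primrec Ck_on :: "nat \<Rightarrow> 'a::euclidean_space set \<Rightarrow> ('a \<Rightarrow> 'b::real_normed_vector) \<Rightarrow> bool" where
  "Ck_on 0 S f \<longleftrightarrow> continuous_on S f"
| "Ck_on (Suc k) S f \<longleftrightarrow> (\<forall>x\<in>S. f differentiable at x)
                      \<and> (\<forall>v. Ck_on k S (\<lambda>x. frechet_derivative f (at x) v))"

definition Ck_near :: "nat \<Rightarrow> 'a::euclidean_space \<Rightarrow> ('a \<Rightarrow> 'b::real_normed_vector) \<Rightarrow> bool" where
  "Ck_near k x f \<longleftrightarrow> (\<exists>U. open U \<and> x \<in> U \<and> Ck_on k U f)"

definition C11_embedding :: "curve \<Rightarrow> bool" where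
  "C11_embedding \<gamma> \<longleftrightarrow> (\<forall>s. \<gamma> (s + 1) = \<gamma> s) \<and> C11_on UNIV \<gamma>
                     \<and> (\<forall>s. velocity \<gamma> s \<noteq> 0) \<and> inj_on \<gamma> {0..<1}"

definition len :: "curve \<Rightarrow> real" where
  "len \<gamma> = integral {0..1} (\<lambda>s. norm (velocity \<gamma> s))"

text \<open>Federer: \<open>reach_at A a\<close> is the supremum of the radii of balls about \<open>a\<close> all of whose points
  have a unique nearest point in \<open>A\<close>.\<close>

definition unique_nearest :: "'a::metric_space set \<Rightarrow> 'a set" where
  "unique_nearest A = {x. \<exists>!p. p \<in> A \<and> dist x p = infdist x A}"

definition reach_at :: "'a::metric_space set \<Rightarrow> 'a \<Rightarrow> ereal" where
  "reach_at A a = (SUP r\<in>{r. 0 \<le> r \<and> ball a r \<subseteq> unique_nearest A}. ereal r)"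

definition reach :: "'a::metric_space set \<Rightarrow> ereal" where
  "reach A = (INF a\<in>A. reach_at A a)"

definition thickness :: "curve \<Rightarrow> ereal" where
  "thickness \<gamma> = reach (range \<gamma>)"

definition rop :: "curve \<Rightarrow> real" where
  "rop \<gamma> = len \<gamma> / real_of_ereal (thickness \<gamma>)"


section \<open>Knot types\<close>

text \<open>Only the values of \<open>H t\<close> on \<open>X\<close>, for \<open>t \<in> {0..1}\<close>, are meaningful.\<close>

definition ambient_isotopy :: "'a::topological_space set \<Rightarrow> (real \<Rightarrow> 'a \<Rightarrow> 'a) \<Rightarrow> bool" where
  "ambient_isotopy X H \<longleftrightarrow> continuous_on ({0..1} \<times> X) (\<lambda>(t, x). H t x)
     \<and> (\<forall>t\<in>{0..1}. \<exists>G. homeomorphism X X (H t) G) \<and> (\<forall>x\<in>X. H 0 x = x)"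

definition polygonal_knot :: "(real^3) set \<Rightarrow> bool" where
  "polygonal_knot C \<longleftrightarrow> (\<exists>g. simple_path g \<and> pathfinish g = pathstart g \<and> path_image g = C)
     \<and> (\<exists>S. finite S \<and> C = (\<Union>(a, b)\<in>S. closed_segment a b))"

text \<open>Knot types are classes of subsets of space, hence unoriented; tameness means that the class
  contains a polygonal knot.\<close>

definition knot_type :: "(real^3) set set \<Rightarrow> bool" where
  "knot_type K \<longleftrightarrow>
     (\<exists>C. polygonal_knot C \<and> K = {C'. \<exists>H. ambient_isotopy UNIV H \<and> C' = H 1 ` C})"

definition embeddings :: "(real^3) set set \<Rightarrow> curve set" where
  "embeddings K = {\<gamma>. C11_embedding \<gamma> \<and> range \<gamma> \<in> K \<and> 0 < thickness \<gamma>}"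


section \<open>The sublevel spaces\<close>

definition curve_space :: "(real^3) set set \<Rightarrow> (real^3) set set" where
  "curve_space K = range ` embeddings K"

definition C11_norm :: "(real \<Rightarrow> 'a::real_normed_vector) \<Rightarrow> real" where
  "C11_norm v = (SUP s. norm (v s)) + (SUP s. norm (velocity v s))
              + Inf {L. L-lipschitz_on UNIV (velocity v)}"

text \<open>\<open>C'\<close> is the graph over \<open>C\<close> of a normal field of small norm. The constant-speed
  parametrization makes the norm independent of choices.\<close>

definition normal_graph_close :: "real \<Rightarrow> (real^3) set \<Rightarrow> (real^3) set \<Rightarrow> bool" where
  "normal_graph_close \<epsilon> C C' \<longleftrightarrow> (\<exists>\<gamma> v. C11_embedding \<gamma> \<and> range \<gamma> = C
     \<and> (\<exists>l. \<forall>s. norm (velocity \<gamma> s) = l)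
     \<and> (\<forall>s. v (s + 1) = v s) \<and> C11_on UNIV v \<and> (\<forall>s. v s \<bullet> velocity \<gamma> s = 0)
     \<and> C' = range (\<lambda>s. \<gamma> s + v s) \<and> C11_norm v < \<epsilon>)"

definition open_curve_set :: "(real^3) set set \<Rightarrow> (real^3) set set \<Rightarrow> bool" where
  "open_curve_set K U \<longleftrightarrow> U \<subseteq> curve_space K
     \<and> (\<forall>C\<in>U. \<exists>\<epsilon>>0. \<forall>C'\<in>curve_space K. normal_graph_close \<epsilon> C C' \<longrightarrow> C' \<in> U)"

definition curve_topology :: "(real^3) set set \<Rightarrow> (real^3) set topology" where
  "curve_topology K = topology (open_curve_set K)"

lemma normal_graph_close_mono:
  "normal_graph_close \<epsilon> C C' \<Longrightarrow> \<epsilon> \<le> \<delta> \<Longrightarrow> normal_graph_close \<delta> C C'"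
  unfolding normal_graph_close_def by (elim exE conjE, intro exI conjI) (assumption | erule (1) order_less_le_trans)+

lemma istopology_open_curve_set: "istopology (open_curve_set K)"
  unfolding istopology_def
proof (intro conjI allI impI)
  fix S T assume S: "open_curve_set K S" and T: "open_curve_set K T"
  show "open_curve_set K (S \<inter> T)"
    unfolding open_curve_set_def
  proof (intro conjI ballI)
    show "S \<inter> T \<subseteq> curve_space K" using S unfolding open_curve_set_def by blast
    fix C assume C: "C \<in> S \<inter> T"
    from C S obtain a where a: "a > 0"
      "\<forall>C'\<in>curve_space K. normal_graph_close a C C' \<longrightarrow> C' \<in> S"
      unfolding open_curve_set_def by blast
    from C T obtain b where b: "b > 0"
      "\<forall>C'\<in>curve_space K. normal_graph_close b C C' \<longrightarrow> C' \<in> T"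
      unfolding open_curve_set_def by blast
    have "\<forall>C'\<in>curve_space K. normal_graph_close (min a b) C C' \<longrightarrow> C' \<in> S \<inter> T"
      using a(2) b(2) normal_graph_close_mono[of "min a b"] by (meson IntI min.cobounded1 min.cobounded2)
    then show "\<exists>\<epsilon>>0. \<forall>C'\<in>curve_space K. normal_graph_close \<epsilon> C C' \<longrightarrow> C' \<in> S \<inter> T"
      using a(1) b(1) by (intro exI[of _ "min a b"]) auto
  qed
next
  fix \<K> assume "\<forall>S\<in>\<K>. open_curve_set K S"
  then show "open_curve_set K (\<Union>\<K>)"
    unfolding open_curve_set_def by (meson Union_iff Union_least)
qed

definition similarities :: "real^3 \<Rightarrow> (real^3 \<Rightarrow> real^3) set" where
  "similarities u = {f. \<exists>l R b. 0 < l \<and> orthogonal_transformation R \<and> det (matrix R) = 1 \<and> R u = u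
                              \<and> f = (\<lambda>x. l *\<^sub>R R x + b)}"

definition sim_class :: "real^3 \<Rightarrow> (real^3) set \<Rightarrow> (real^3) set set" where
  "sim_class u C = (\<lambda>f. f ` C) ` similarities u"

definition sublevel_curves :: "real \<Rightarrow> (real^3) set set \<Rightarrow> (real^3) set set" where
  "sublevel_curves \<Lambda> K = range ` {\<gamma> \<in> embeddings K. rop \<gamma> \<le> \<Lambda>}"

definition sublevel_space :: "real \<Rightarrow> real^3 \<Rightarrow> (real^3) set set \<Rightarrow> (real^3) set set set" where
  "sublevel_space \<Lambda> u K = sim_class u ` sublevel_curves \<Lambda> K"

text \<open>The quotient topology of the subspace topology.\<close>

definition open_sublevel_set :: "real \<Rightarrow> real^3 \<Rightarrow> (real^3) set set \<Rightarrow> (real^3) set set set \<Rightarrow> bool" where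
  "open_sublevel_set \<Lambda> u K W \<longleftrightarrow> W \<subseteq> sublevel_space \<Lambda> u K
     \<and> openin (subtopology (curve_topology K) (sublevel_curves \<Lambda> K))
              {C \<in> sublevel_curves \<Lambda> K. sim_class u C \<in> W}"

definition sublevel_topology :: "real \<Rightarrow> real^3 \<Rightarrow> (real^3) set set \<Rightarrow> (real^3) set set topology" where
  "sublevel_topology \<Lambda> u K = topology (open_sublevel_set \<Lambda> u K)"

lemma istopology_open_sublevel_set: "istopology (open_sublevel_set \<Lambda> u K)"
  unfolding istopology_def
proof (intro conjI allI impI)
  fix S T assume S: "open_sublevel_set \<Lambda> u K S" and T: "open_sublevel_set \<Lambda> u K T"
  have "{C \<in> sublevel_curves \<Lambda> K. sim_class u C \<in> S \<inter> T} =
        {C \<in> sublevel_curves \<Lambda> K. sim_class u C \<in> S} \<inter> {C \<in> sublevel_curves \<Lambda> K. sim_class u C \<in> T}"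
    by blast
  with S T show "open_sublevel_set \<Lambda> u K (S \<inter> T)"
    unfolding open_sublevel_set_def by auto
next
  fix \<K> assume A: "\<forall>S\<in>\<K>. open_sublevel_set \<Lambda> u K S"
  have "{C \<in> sublevel_curves \<Lambda> K. sim_class u C \<in> \<Union>\<K>} =
        \<Union>((\<lambda>S. {C \<in> sublevel_curves \<Lambda> K. sim_class u C \<in> S}) ` \<K>)"
    by blast
  moreover have "openin (subtopology (curve_topology K) (sublevel_curves \<Lambda> K))
        (\<Union>((\<lambda>S. {C \<in> sublevel_curves \<Lambda> K. sim_class u C \<in> S}) ` \<K>))"
    using A unfolding open_sublevel_set_def by (intro openin_Union) blast
  ultimately show "open_sublevel_set \<Lambda> u K (\<Union>\<K>)"
    using A unfolding open_sublevel_set_def by (auto simp del: Union_iff UN_iff)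
qed


lemma openin_curve_topology: "openin (curve_topology K) U \<longleftrightarrow> open_curve_set K U"
  unfolding curve_topology_def using istopology_open_curve_set by (metis topology_inverse')

lemma openin_sublevel_topology: "openin (sublevel_topology \<Lambda> u K) W \<longleftrightarrow> open_sublevel_set \<Lambda> u K W"
  unfolding sublevel_topology_def using istopology_open_sublevel_set by (metis topology_inverse')

lemma topspace_curve_topology: "topspace (curve_topology K) = curve_space K"
  unfolding topspace_def openin_curve_topology open_curve_set_def by (blast intro: zero_less_one)

lemma topspace_sublevel_topology: "topspace (sublevel_topology \<Lambda> u K) = sublevel_space \<Lambda> u K"
proof -
  have sub: "sublevel_curves \<Lambda> K \<subseteq> topspace (curve_topology K)"
    unfolding topspace_curve_topology sublevel_curves_def curve_space_def by blast
  have "{C \<in> sublevel_curves \<Lambda> K. sim_class u C \<in> sublevel_space \<Lambda> u K} = sublevel_curves \<Lambda> K"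
    unfolding sublevel_space_def by blast
  then have "open_sublevel_set \<Lambda> u K (sublevel_space \<Lambda> u K)"
    unfolding open_sublevel_set_def using sub by (metis openin_topspace order_refl topspace_subtopology_subset)
  then show ?thesis
    unfolding topspace_def openin_sublevel_topology by (auto simp: open_sublevel_set_def)
qed


section \<open>Movies\<close>

text \<open>\<open>I\<close> is the finite subdivision of time.\<close>

definition piecewise_C11 :: "movie \<Rightarrow> bool" where
  "piecewise_C11 \<Gamma> \<longleftrightarrow> (\<exists>I. finite I \<and>
     (\<forall>a b. 0 \<le> a \<and> a < b \<and> b \<le> 1 \<and> {a<..<b} \<inter> I = {} \<longrightarrow>
        C11_on ({a..b} \<times> UNIV) (\<lambda>(t, s). \<Gamma> t s)))"

definition admissible_movie :: "(real^3) set set \<Rightarrow> movie \<Rightarrow> bool" where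
  "admissible_movie K \<Gamma> \<longleftrightarrow> piecewise_C11 \<Gamma> \<and> (\<forall>t\<in>{0..1}. \<Gamma> t \<in> embeddings K)
     \<and> (\<exists>c>0. \<forall>t\<in>{0..1}. \<forall>s. c \<le> norm (velocity (\<Gamma> t) s))"

definition level_admissible_movie :: "real \<Rightarrow> (real^3) set set \<Rightarrow> movie \<Rightarrow> bool" where
  "level_admissible_movie \<Lambda> K \<Gamma> \<longleftrightarrow> admissible_movie K \<Gamma> \<and> (\<forall>t\<in>{0..1}. rop (\<Gamma> t) \<le> \<Lambda>)"


section \<open>Projections and Reidemeister walls\<close>

definition proj :: "real^3 \<Rightarrow> real^3 \<Rightarrow> real^3" where
  "proj u x = x - (x \<bullet> u) *\<^sub>R u"

text \<open>For a unit vector \<open>u\<close>, the oriented area spanned by two vectors of the plane normal to \<open>u\<close>;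
  it vanishes iff they are linearly dependent.\<close>

definition area :: "real^3 \<Rightarrow> real^3 \<Rightarrow> real^3 \<Rightarrow> real" where
  "area u a b = u \<bullet> cross3 a b"

definition cusps :: "real^3 \<Rightarrow> curve \<Rightarrow> real set" where
  "cusps u \<gamma> = {s \<in> {0..<1}. velocity (\<lambda>s. proj u (\<gamma> s)) s = 0}"

text \<open>Multiple points are recorded by sets of \<open>n\<close> parameters, so that a point through which exactly
  three strands pass gives one element for \<open>n = 3\<close> and a quadruple point gives four.\<close>

definition multipoints :: "real^3 \<Rightarrow> nat \<Rightarrow> curve \<Rightarrow> real set set" where
  "multipoints u n \<gamma> = {A. A \<subseteq> {0..<1} \<and> card A = n \<and> (\<exists>x. \<forall>s\<in>A. proj u (\<gamma> s) = x)}"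

definition tangencies :: "real^3 \<Rightarrow> curve \<Rightarrow> real set set" where
  "tangencies u \<gamma> = {A \<in> multipoints u 2 \<gamma>. \<forall>s\<in>A. \<forall>s'\<in>A.
     area u (velocity (\<lambda>s. proj u (\<gamma> s)) s) (velocity (\<lambda>s. proj u (\<gamma> s)) s') = 0}"

definition regular_projection :: "real^3 \<Rightarrow> curve \<Rightarrow> bool" where
  "regular_projection u \<gamma> \<longleftrightarrow> finite (multipoints u 2 \<gamma>) \<and> cusps u \<gamma> = {}
     \<and> tangencies u \<gamma> = {} \<and> multipoints u 3 \<gamma> = {}"

datatype wall = R1 | R2 | R3

text \<open>
  \<open>A\<close> is the set of parameters of the unique singular point, near which the projection is required
  to be thrice continuously differentiable. The standard singularities are the ordinary cusp
  (\<open>c''\<close>, \<open>c'''\<close> independent), the simple self-tangency (different curvatures relative to the common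
  tangent line), and the triple point with pairwise transverse branches. In the first case the
  condition on tangencies also keeps other strands off the cusp.
\<close>

definition on_wall :: "real^3 \<Rightarrow> wall \<Rightarrow> real set \<Rightarrow> curve \<Rightarrow> bool" where
  "on_wall u \<tau> A \<gamma> \<longleftrightarrow>
    (let c = (\<lambda>s. proj u (\<gamma> s)); c' = velocity c; c'' = velocity c'; c''' = velocity c'' in
     finite (multipoints u 2 \<gamma>) \<and> (\<forall>s\<in>A. Ck_near 3 s c) \<and>
     (case \<tau> of
       R1 \<Rightarrow> cusps u \<gamma> = A \<and> card A = 1 \<and> tangencies u \<gamma> = {} \<and> multipoints u 3 \<gamma> = {}
             \<and> (\<forall>s\<in>A. area u (c'' s) (c''' s) \<noteq> 0)
     | R2 \<Rightarrow> cusps u \<gamma> = {} \<and> tangencies u \<gamma> = {A} \<and> multipoints u 3 \<gamma> = {}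
             \<and> (\<forall>s\<in>A. \<forall>s'\<in>A. s \<noteq> s' \<longrightarrow>
                  area u (c' s) (c'' s /\<^sub>R (norm (c' s))\<^sup>2 - c'' s' /\<^sub>R (norm (c' s'))\<^sup>2) \<noteq> 0)
     | R3 \<Rightarrow> cusps u \<gamma> = {} \<and> tangencies u \<gamma> = {} \<and> multipoints u 3 \<gamma> = {A}))"

text \<open>
  Transversality of the path to the wall, expressed by first derivatives in time of the projected
  movie \<open>c\<close>: the zero of the velocity at the cusp unfolds versally; the two tangent branches
  separate with nonzero normal speed; no velocity \<open>w\<close> of a common point is compatible, to first
  order, with the motion of all three branches. All conditions are independent of the
  parametrization of the branches.
\<close>

definition crosses_wall :: "real^3 \<Rightarrow> wall \<Rightarrow> movie \<Rightarrow> real \<Rightarrow> bool" where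
  "crosses_wall u \<tau> \<Gamma> t \<longleftrightarrow> (\<exists>A. on_wall u \<tau> A (\<Gamma> t) \<and>
    (let c = (\<lambda>t s. proj u (\<Gamma> t s)); c_s = (\<lambda>t. velocity (c t));
         c_t = (\<lambda>s. velocity (\<lambda>t. c t s) t) in
     (\<forall>s\<in>A. Ck_near 3 (t, s) (\<lambda>(t, s). c t s)) \<and>
     (case \<tau> of
       R1 \<Rightarrow> \<forall>s\<in>A. area u (velocity (c_s t) s) (velocity (\<lambda>t. c_s t s) t) \<noteq> 0
     | R2 \<Rightarrow> \<forall>s\<in>A. \<forall>s'\<in>A. s \<noteq> s' \<longrightarrow> area u (c_s t s) (c_t s - c_t s') \<noteq> 0
     | R3 \<Rightarrow> \<nexists>w. \<forall>s\<in>A. area u (c_s t s) (c_t s - w) = 0)))"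

definition projection_generic :: "real^3 \<Rightarrow> movie \<Rightarrow> bool" where
  "projection_generic u \<Gamma> \<longleftrightarrow> (\<exists>T. finite T \<and> T \<subseteq> {0<..<1}
     \<and> (\<forall>t\<in>{0..1} - T. regular_projection u (\<Gamma> t))
     \<and> (\<forall>t\<in>T. \<exists>\<tau>. crosses_wall u \<tau> \<Gamma> t))"

definition single_crossing :: "real^3 \<Rightarrow> wall \<Rightarrow> movie \<Rightarrow> bool" where
  "single_crossing u \<tau> \<Gamma> \<longleftrightarrow> (\<exists>t\<^sub>0\<in>{0<..<1}. crosses_wall u \<tau> \<Gamma> t\<^sub>0
     \<and> (\<forall>t\<in>{0..1} - {t\<^sub>0}. regular_projection u (\<Gamma> t)))"


section \<open>Diagrams on the sphere\<close>

text \<open>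
  The sphere \<open>u\<^sup>\<bottom> \<union> {\<infinity>}\<close> is realized as the unit sphere by inverse stereographic projection, with
  \<open>\<infinity>\<close> mapped to \<open>u\<close>. A picture is a closed curve on the sphere together with the set of
  parameter pairs \<open>(s, s')\<close> at which the strand of \<open>s\<close> passes over the strand of \<open>s'\<close>.
\<close>

type_synonym picture = "curve \<times> (real \<times> real) set"
type_synonym diagram = "picture set"

abbreviation S2 :: "(real^3) set" where "S2 \<equiv> sphere 0 1"

definition to_sphere :: "real^3 \<Rightarrow> real^3 \<Rightarrow> real^3" where
  "to_sphere u x = (2 / ((norm x)\<^sup>2 + 1)) *\<^sub>R x + (((norm x)\<^sup>2 - 1) / ((norm x)\<^sup>2 + 1)) *\<^sub>R u"

definition picture :: "real^3 \<Rightarrow> curve \<Rightarrow> picture" where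
  "picture u \<gamma> = (\<lambda>s. to_sphere u (proj u (\<gamma> s)),
                  {(s, s'). proj u (\<gamma> s) = proj u (\<gamma> s') \<and> \<gamma> s' \<bullet> u < \<gamma> s \<bullet> u})"

text \<open>Lifts of homeomorphisms of the circle of either orientation, diagrams being unoriented.\<close>

definition circle_homeo :: "(real \<Rightarrow> real) \<Rightarrow> bool" where
  "circle_homeo \<phi> \<longleftrightarrow> continuous_on UNIV \<phi> \<and> bij \<phi> \<and> (\<exists>\<epsilon>\<in>{1, -1}. \<forall>s. \<phi> (s + 1) = \<phi> s + \<epsilon>)"

definition carries :: "(real^3 \<Rightarrow> real^3) \<Rightarrow> (real \<Rightarrow> real) \<Rightarrow> picture \<Rightarrow> picture \<Rightarrow> bool" where
  "carries h \<phi> p q \<longleftrightarrow> (\<forall>s. fst q (\<phi> s) = h (fst p s))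
     \<and> (\<forall>s s'. (\<phi> s, \<phi> s') \<in> snd q \<longleftrightarrow> (s, s') \<in> snd p)"

text \<open>Isotopies start at the identity and are thus orientation-preserving.\<close>

definition diagram_of_picture :: "picture \<Rightarrow> diagram" where
  "diagram_of_picture p =
     {q. \<exists>H \<phi>. ambient_isotopy S2 H \<and> circle_homeo \<phi> \<and> carries (H 1) \<phi> p q}"

definition diagram :: "real^3 \<Rightarrow> curve \<Rightarrow> diagram" where
  "diagram u \<gamma> = diagram_of_picture (picture u \<gamma>)"


section \<open>The Reidemeister graph\<close>

text \<open>
  A single Reidemeister move is the passage of a diagram through one Reidemeister wall, i.e. the
  family of pictures of a movie with a single crossing. Two moves coincide under diagram isotopy
  if a time-dependent isotopy of the sphere carries one family to the other, up to increasing
  reparametrization \<open>\<theta>\<close> of time. No ropelength bound is imposed.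
\<close>

type_synonym move = "real \<Rightarrow> picture"

definition move_of :: "real^3 \<Rightarrow> movie \<Rightarrow> move" where
  "move_of u \<Gamma> = (\<lambda>t. picture u (\<Gamma> t))"

definition move_isotopic :: "move \<Rightarrow> move \<Rightarrow> bool" where
  "move_isotopic m m' \<longleftrightarrow> (\<exists>\<Phi> \<phi> \<theta>.
     continuous_on ({0..1} \<times> S2) (\<lambda>(t, x). \<Phi> t x)
     \<and> (\<forall>t\<in>{0..1}. \<exists>G. homeomorphism S2 S2 (\<Phi> t) G)
     \<and> (\<exists>H. ambient_isotopy S2 H \<and> (\<forall>x\<in>S2. H 1 x = \<Phi> 0 x))
     \<and> continuous_on ({0..1} \<times> UNIV) (\<lambda>(t, s). \<phi> t s) \<and> (\<forall>t\<in>{0..1}. circle_homeo (\<phi> t))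
     \<and> continuous_on {0..1} \<theta> \<and> strict_mono_on {0..1} \<theta> \<and> \<theta> 0 = 0 \<and> \<theta> 1 = (1::real)
     \<and> (\<forall>t\<in>{0..1}. carries (\<Phi> t) (\<phi> t) (m t) (m' (\<theta> t))))"

text \<open>
  An arc carries its initial diagram, the isotopy class of the move, and its final diagram.
  The multigraph is represented by a multi-digraph in which each edge occurs with its two
  orientations, as the move and its inverse.
\<close>

type_synonym arc = "diagram \<times> move set \<times> diagram"

definition arc_of :: "real^3 \<Rightarrow> movie \<Rightarrow> arc" where
  "arc_of u \<Gamma> = (diagram u (\<Gamma> 0), {m. move_isotopic (move_of u \<Gamma>) m}, diagram u (\<Gamma> 1))"

definition reidemeister_arcs :: "real^3 \<Rightarrow> (real^3) set set \<Rightarrow> wall \<Rightarrow> arc set" where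
  "reidemeister_arcs u K \<tau> = arc_of u ` {\<Gamma>. admissible_movie K \<Gamma> \<and> single_crossing u \<tau> \<Gamma>}"

definition G_S :: "real^3 \<Rightarrow> (real^3) set set \<Rightarrow> (diagram, arc) pre_digraph" where
  "G_S u K = \<lparr> verts = diagram u ` {\<gamma> \<in> embeddings K. regular_projection u \<gamma>},
               arcs = (\<Union>\<tau>. reidemeister_arcs u K \<tau>),
               tail = fst, head = (\<lambda>e. snd (snd e)) \<rparr>"

definition realizes :: "real^3 \<Rightarrow> movie \<Rightarrow> arc \<Rightarrow> bool" where
  "realizes u \<Gamma> e \<longleftrightarrow> (\<exists>\<tau>. single_crossing u \<tau> \<Gamma>) \<and> arc_of u \<Gamma> = e"


section \<open>Fiber components and the lifted graph\<close>

type_synonym component = "(real^3) set set set"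

definition fiber :: "real \<Rightarrow> real^3 \<Rightarrow> (real^3) set set \<Rightarrow> diagram \<Rightarrow> component" where
  "fiber \<Lambda> u K D = {x \<in> sublevel_space \<Lambda> u K.
     \<exists>\<gamma>. C11_embedding \<gamma> \<and> range \<gamma> \<in> x \<and> regular_projection u \<gamma> \<and> diagram u \<gamma> = D}"

definition fiber_topology ::
    "real \<Rightarrow> real^3 \<Rightarrow> (real^3) set set \<Rightarrow> diagram \<Rightarrow> (real^3) set set topology" where
  "fiber_topology \<Lambda> u K D = subtopology (sublevel_topology \<Lambda> u K) (fiber \<Lambda> u K D)"

definition lift_graph ::
    "real \<Rightarrow> real^3 \<Rightarrow> (real^3) set set \<Rightarrow> (diagram \<times> component, arc \<times> component \<times> component) pre_digraph"
  where
  "lift_graph \<Lambda> u K =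
     \<lparr> verts = {(D, F). D \<in> verts (G_S u K) \<and> F \<in> path_components_of (fiber_topology \<Lambda> u K D)},
       arcs = {(e, F, F'). e \<in> arcs (G_S u K)
          \<and> F \<in> path_components_of (fiber_topology \<Lambda> u K (tail (G_S u K) e))
          \<and> F' \<in> path_components_of (fiber_topology \<Lambda> u K (head (G_S u K) e))
          \<and> (\<exists>\<Gamma>. level_admissible_movie \<Lambda> K \<Gamma> \<and> projection_generic u \<Gamma> \<and> realizes u \<Gamma> e
                 \<and> sim_class u (range (\<Gamma> 0)) \<in> F \<and> sim_class u (range (\<Gamma> 1)) \<in> F')},
       tail = (\<lambda>(e, F, F'). (tail (G_S u K) e, F)),
       head = (\<lambda>(e, F, F'). (head (G_S u K) e, F')) \<rparr>"

definition visible_graph :: "real \<Rightarrow> real^3 \<Rightarrow> (real^3) set set \<Rightarrow> (diagram, arc) pre_digraph" where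
  "visible_graph \<Lambda> u K = \<lparr> verts = fst ` verts (lift_graph \<Lambda> u K),
                           arcs = fst ` arcs (lift_graph \<Lambda> u K),
                           tail = tail (G_S u K), head = head (G_S u K) \<rparr>"

text \<open>The specified edges are the arcs of \<open>Q\<close>.\<close>

definition vertex_coherent_lift ::
    "real \<Rightarrow> real^3 \<Rightarrow> (real^3) set set \<Rightarrow> (diagram, arc) pre_digraph \<Rightarrow> (diagram \<Rightarrow> component) \<Rightarrow> bool"
  where
  "vertex_coherent_lift \<Lambda> u K Q F \<longleftrightarrow>
     subgraph Q (G_S u K) \<and> finite (verts Q) \<and> finite (arcs Q)
     \<and> (\<forall>D\<in>verts Q. (D, F D) \<in> verts (lift_graph \<Lambda> u K))
     \<and> (\<forall>e\<in>arcs Q. (e, F (tail Q e), F (head Q e)) \<in> arcs (lift_graph \<Lambda> u K))"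


section \<open>Separated systems\<close>

text \<open>
  A movie is stationary outside \<open>B\<close> if a point of the circle that is outside \<open>B\<close> at time 0 or at
  time \<open>t\<close> has not moved; in particular the points starting in \<open>B\<close> stay in \<open>B\<close>.
\<close>

definition stationary_outside :: "(real^3) set \<Rightarrow> movie \<Rightarrow> bool" where
  "stationary_outside B \<Gamma> \<longleftrightarrow>
     (\<forall>t\<in>{0..1}. \<forall>s. \<Gamma> 0 s \<notin> B \<or> \<Gamma> t s \<notin> B \<longrightarrow> \<Gamma> t s = \<Gamma> 0 s)"

definition separated_system ::
    "real^3 \<Rightarrow> (real^3) set set \<Rightarrow> curve \<Rightarrow> nat \<Rightarrow> (nat \<Rightarrow> movie) \<Rightarrow> (nat \<Rightarrow> (real^3) set) \<Rightarrow> (nat \<Rightarrow> wall) \<Rightarrow> bool"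
  where
  "separated_system u K \<gamma>\<^sub>0 k \<Gamma> B \<tau> \<longleftrightarrow>
     (\<forall>i\<in>{1..k}. (\<exists>z r. 0 < r \<and> B i = cball z r)
        \<and> admissible_movie K (\<Gamma> i) \<and> (\<forall>t\<in>{0..1}. 1 \<le> thickness (\<Gamma> i t))
        \<and> \<Gamma> i 0 = \<gamma>\<^sub>0 \<and> stationary_outside (B i) (\<Gamma> i) \<and> single_crossing u (\<tau> i) (\<Gamma> i))
     \<and> (\<forall>i\<in>{1..k}. \<forall>j\<in>{1..k}. i \<noteq> j \<longrightarrow>
          2 \<le> setdist (B i) (B j) \<and> proj u ` B i \<inter> proj u ` B j = {})"

definition composite_state ::
    "curve \<Rightarrow> (nat \<Rightarrow> movie) \<Rightarrow> (nat \<Rightarrow> (real^3) set) \<Rightarrow> nat set \<Rightarrow> curve" where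
  "composite_state \<gamma>\<^sub>0 \<Gamma> B S = (\<lambda>s. if \<exists>i\<in>S. \<gamma>\<^sub>0 s \<in> B i
      then \<Gamma> (THE i. i \<in> S \<and> \<gamma>\<^sub>0 s \<in> B i) 1 s else \<gamma>\<^sub>0 s)"

definition composite_movie ::
    "curve \<Rightarrow> (nat \<Rightarrow> movie) \<Rightarrow> (nat \<Rightarrow> (real^3) set) \<Rightarrow> nat set \<Rightarrow> nat \<Rightarrow> movie" where
  "composite_movie \<gamma>\<^sub>0 \<Gamma> B S i = (\<lambda>t s. if \<gamma>\<^sub>0 s \<in> B i then \<Gamma> i t s
      else composite_state \<gamma>\<^sub>0 \<Gamma> B (insert i S) s)"

definition cube_level :: "curve \<Rightarrow> nat \<Rightarrow> (nat \<Rightarrow> movie) \<Rightarrow> real" where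
  "cube_level \<gamma>\<^sub>0 k \<Gamma> =
     len \<gamma>\<^sub>0 + (\<Sum>i=1..k. max 0 ((SUP t\<in>{0..1}. len (\<Gamma> i t)) - len \<gamma>\<^sub>0))"

definition cube :: "real^3 \<Rightarrow> (real^3) set set \<Rightarrow> curve \<Rightarrow> nat \<Rightarrow> (nat \<Rightarrow> movie) \<Rightarrow> (nat \<Rightarrow> (real^3) set)
    \<Rightarrow> (diagram, arc) pre_digraph" where
  "cube u K \<gamma>\<^sub>0 k \<Gamma> B =
     \<lparr> verts = (\<lambda>S. diagram u (composite_state \<gamma>\<^sub>0 \<Gamma> B S)) ` Pow {1..k},
       arcs = {arc_of u (composite_movie \<gamma>\<^sub>0 \<Gamma> B S i) | S i. S \<subseteq> {1..k} \<and> i \<in> {1..k} - S},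
       tail = tail (G_S u K), head = head (G_S u K) \<rparr>"

end

theory Submission
  imports Defs
begin

text \<open>
  Stop each move \<open>j\<close> at its own time \<open>\<theta> j\<close>. Since the balls are disjoint, the displacements have disjoint
  supports and add up to a composite curve which near every parameter coincides with one of the
  curves \<open>\<Gamma> j (\<theta> j)\<close> or with \<open>\<gamma>\<^sub>0\<close>. Smoothness is therefore local and the length increments add up.
  Reach at least 1 is tested in balls of radius 1, which meet at most one \<open>B j\<close>; likewise the
  disjointness of the shadows confines each multiple point of the projection to one such curve, and
  a singularity of the moving curve can only occur in its ball, \<open>\<gamma>\<^sub>0\<close> being regular.
  Finally, the knot type is constant along a movie: two nearby time slices differ by a displacement
  that is Lipschitz with a small constant along the curve, and a Lipschitz extension \<open>\<psi>\<close> of it to space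
  gives the ambient isotopy \<open>x + t \<psi>(x)\<close>.
\<close>

section \<open>Calculus of C11 maps\<close>

text \<open>The stopping times are arbitrary points of [0,1] because one family,
  \<open>composite\<close>, then contains both the composite states (all times 0 or 1) and the
  slices of composite movies (one time running). Embeddedness, thickness and length are thus treated
  once for both. Only the projection needs more: all moves except the running one must stand at time
  0 or 1, where a movie with a single interior crossing is regular.

  The knot type is the one property that is not local: a composite curve shares its germs with given
  curves but need not be a slice of any given movie. It is reached from
  \<open>\<gamma>\<^sub>0\<close> by running the moves one after another, each run being a piecewise
  C11 movie of embedded curves. Along such a movie the velocities of nearby slices are uniformly
  close, which controls the displacement in terms of the parameter. A Lipschitz bound along the
  curve asks for control in terms of distance in space; the chord-arc inequality of an embedded
  closed curve converts one into the other.\<close>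

lemma velocity_cong:
  assumes "\<forall>\<^sub>F x in nhds s. f x = g x"
  shows "velocity f s = velocity g s"
  unfolding velocity_def
  by (rule vector_derivative_cong_eq) (use assms in \<open>auto elim: eventually_mono\<close>)

lemma eventually_velocity_cong:
  assumes "\<forall>\<^sub>F x in nhds s. f x = g x"
  shows "\<forall>\<^sub>F x in nhds s. velocity f x = velocity g x"
proof -
  have "\<forall>\<^sub>F x in nhds s. \<forall>\<^sub>F y in nhds x. f y = g y"
    using assms by (simp add: eventually_eventually)
  then show ?thesis by (rule eventually_mono) (rule velocity_cong)
qed

text \<open>On an open set derivatives depend only on the values there, so equality passes to the
  directional derivatives; the induction therefore generalizes over both functions.\<close>

lemma Ck_on_cong:
  assumes "open S" "\<And>x. x \<in> S \<Longrightarrow> f x = g x" "Ck_on k S f"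
  shows "Ck_on k S g"
  using assms(2,3)
proof (induction k arbitrary: f g)
  case 0
  then show ?case by (metis Ck_on.simps(1) continuous_on_cong)
next
  case (Suc k)
  have d: "f differentiable at x" if "x \<in> S" for x
    using Suc.prems(2) that by simp
  have d': "g differentiable at x" if "x \<in> S" for x
    using d[OF that] Suc.prems(1) \<open>open S\<close> that
    unfolding differentiable_def by (meson has_derivative_transform_within_open)
  have e: "frechet_derivative f (at x) v = frechet_derivative g (at x) v" if "x \<in> S" for x v
    using frechet_derivative_transform_within_open[OF d[OF that] \<open>open S\<close> that] Suc.prems(1) by metis
  have "Ck_on k S (\<lambda>x. frechet_derivative g (at x) v)" for v
    by (rule Suc.IH[of "\<lambda>x. frechet_derivative f (at x) v"]) (use e Suc.prems(2) in auto)
  with d' show ?case by simp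
qed

lemma Ck_on_subset: "Ck_on k S f \<Longrightarrow> T \<subseteq> S \<Longrightarrow> Ck_on k T f"
  by (induction k arbitrary: f) (auto intro: continuous_on_subset)

lemma Ck_near_cong:
  assumes "\<forall>\<^sub>F y in nhds x. f y = g y" "Ck_near k x f"
  shows "Ck_near k x g"
proof -
  from assms(1) obtain V where V: "open V" "x \<in> V" "\<And>y. y \<in> V \<Longrightarrow> f y = g y"
    unfolding eventually_nhds by blast
  from assms(2) obtain U where U: "open U" "x \<in> U" "Ck_on k U f"
    unfolding Ck_near_def by blast
  have "Ck_on k (U \<inter> V) g"
    by (rule Ck_on_cong[of _ f]) (use U V in \<open>auto intro: Ck_on_subset\<close>)
  then show ?thesis unfolding Ck_near_def using U V by (intro exI[of _ "U \<inter> V"]) auto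
qed

lemma C11_on_cong:
  assumes "\<And>x. x \<in> S \<Longrightarrow> f x = g x" "C11_on S f"
  shows "C11_on S g"
proof -
  from assms(2) obtain f' L where
    "\<And>x. x \<in> S \<Longrightarrow> (f has_derivative blinfun_apply (f' x)) (at x within S)" "L-lipschitz_on S f'"
    unfolding C11_on_def by blast
  with has_derivative_transform[of _ S g f] assms(1) show ?thesis unfolding C11_on_def by metis
qed

lemma C11_on_add:
  assumes "C11_on S f" "C11_on S g"
  shows "C11_on S (\<lambda>x. f x + g x)"
proof -
  from assms obtain f' L g' M where
    "\<forall>x\<in>S. (f has_derivative blinfun_apply (f' x)) (at x within S)" "L-lipschitz_on S f'"
    "\<forall>x\<in>S. (g has_derivative blinfun_apply (g' x)) (at x within S)" "M-lipschitz_on S g'"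
    unfolding C11_on_def by blast
  then show ?thesis unfolding C11_on_def
    by (intro exI[of _ "\<lambda>x. f' x + g' x"] exI[of _ "L + M"] conjI ballI)
      (auto simp: plus_blinfun.rep_eq intro!: derivative_eq_intros lipschitz_on_add)
qed

lemma C11_on_uminus:
  assumes "C11_on S f"
  shows "C11_on S (\<lambda>x. - f x)"
proof -
  from assms obtain f' L where
    "\<forall>x\<in>S. (f has_derivative blinfun_apply (f' x)) (at x within S)" "L-lipschitz_on S f'"
    unfolding C11_on_def by blast
  then show ?thesis unfolding C11_on_def
    by (intro exI[of _ "\<lambda>x. - f' x"] exI[of _ L] conjI ballI)
      (auto simp: uminus_blinfun.rep_eq intro!: derivative_eq_intros)
qed

lemma C11_on_diff: "C11_on S f \<Longrightarrow> C11_on S g \<Longrightarrow> C11_on S (\<lambda>x. f x - g x)"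
  using C11_on_add[OF _ C11_on_uminus] by force

lemma C11_on_zero: "C11_on S (\<lambda>x. 0)"
  unfolding C11_on_def by (intro exI[of _ "\<lambda>x. 0"] exI[of _ 0]) (auto simp: lipschitz_on_constant zero_blinfun.rep_eq)

lemma C11_on_sum: "(\<And>i. i \<in> I \<Longrightarrow> C11_on S (f i)) \<Longrightarrow> C11_on S (\<lambda>x. \<Sum>i\<in>I. f i x)"
  by (induction I rule: infinite_finite_induct) (auto intro: C11_on_add C11_on_zero)

text \<open>A fixed curve is viewed as a movie that does not depend on time. In a composite movie
  this is the displacement contributed by all moves that are standing still.\<close>

lemma C11_on_snd:
  fixes f :: "'a::real_normed_vector \<Rightarrow> 'b::real_normed_vector"
    and S :: "('c::real_normed_vector \<times> 'a) set"
  assumes "C11_on UNIV f"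
  shows "C11_on S (\<lambda>(t, s). f s)"
proof -
  from assms obtain f' L where f:
    "\<forall>x. (f has_derivative blinfun_apply (f' x)) (at x)" "L-lipschitz_on UNIV f'"
    unfolding C11_on_def by auto
  let ?snd = "Blinfun snd :: ('c \<times> 'a) \<Rightarrow>\<^sub>L 'a"
  have snd: "blinfun_apply ?snd = snd"
    by (intro bounded_linear_Blinfun_apply bounded_linear_snd)
  have "((\<lambda>p. f (snd p)) has_derivative blinfun_apply (f' (snd p) o\<^sub>L ?snd)) (at p within S)" for p
  proof -
    have "((\<lambda>p. f (snd p)) has_derivative (\<lambda>q. f' (snd p) (snd q))) (at p within S)"
      by (rule has_derivative_compose[of snd snd]) (use f(1) in \<open>auto intro!: derivative_eq_intros\<close>)
    then show ?thesis by (rule has_derivative_eq_rhs) (simp add: snd fun_eq_iff)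
  qed
  moreover have "(L * norm ?snd)-lipschitz_on S (\<lambda>p. f' (snd p) o\<^sub>L ?snd)"
  proof (rule lipschitz_onI)
    have L: "0 \<le> L" using f(2) by (rule lipschitz_on_nonneg)
    then show "0 \<le> L * norm ?snd" by simp
    fix p q :: "'c \<times> 'a"
    have "dist (f' (snd p) o\<^sub>L ?snd) (f' (snd q) o\<^sub>L ?snd) \<le> norm (f' (snd p) - f' (snd q)) * norm ?snd"
      unfolding dist_norm 
      by (metis bounded_bilinear.diff_left[OF bounded_bilinear_blinfun_compose] norm_blinfun_compose)
    also have "\<dots> \<le> (L * dist (snd p) (snd q)) * norm ?snd"
      using lipschitz_onD[OF f(2), of "snd p" "snd q"] by (intro mult_right_mono) (auto simp: dist_norm)
    also have "\<dots> \<le> (L * dist p q) * norm ?snd"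
      using L by (intro mult_right_mono mult_left_mono dist_snd_le) auto
    finally show "dist (f' (snd p) o\<^sub>L ?snd) (f' (snd q) o\<^sub>L ?snd) \<le> L * norm ?snd * dist p q"
      by (simp add: mult_ac)
  qed
  ultimately show ?thesis unfolding C11_on_def split_def
    by (intro exI[of _ "\<lambda>p. f' (snd p) o\<^sub>L ?snd"] exI[of _ "L * norm ?snd"]) simp
qed

section \<open>Velocities of curves and of time slices\<close>

lemma C11_velocity:
  fixes c :: "real \<Rightarrow> 'a::real_normed_vector"
  assumes "C11_on UNIV c"
  shows "(c has_vector_derivative velocity c s) (at s)"
    and "\<exists>L. L-lipschitz_on UNIV (velocity c)"
proof -
  from assms obtain c' L where c:
    "\<forall>x. (c has_derivative blinfun_apply (c' x)) (at x)" "L-lipschitz_on UNIV c'"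
    unfolding C11_on_def by auto
  have vd: "(c has_vector_derivative c' s 1) (at s)" for s
    unfolding has_vector_derivative_def using c(1)[rule_format, of s]
    by (rule has_derivative_eq_rhs) (metis blinfun.scaleR_right mult.right_neutral real_scaleR_def ext)
  then have v: "velocity c s = c' s 1" for s
    unfolding velocity_def by (rule vector_derivative_at)
  show "(c has_vector_derivative velocity c s) (at s)" using vd v by simp
  have "L-lipschitz_on UNIV (velocity c)"
  proof (rule lipschitz_onI)
    show "0 \<le> L" using c(2) by (rule lipschitz_on_nonneg)
    fix x y
    have "dist (velocity c x) (velocity c y) = norm ((c' x - c' y) 1)"
      by (simp add: v dist_norm blinfun.diff_left)
    also have "\<dots> \<le> norm (c' x - c' y)" using norm_blinfun[of "c' x - c' y" 1] by simp
    also have "\<dots> \<le> L * dist x y" using lipschitz_onD[OF c(2), of x y] by (simp add: dist_norm)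
    finally show "dist (velocity c x) (velocity c y) \<le> L * dist x y" .
  qed
  then show "\<exists>L. L-lipschitz_on UNIV (velocity c)" ..
qed

lemma C11_velocity_continuous:
  fixes c :: "real \<Rightarrow> 'a::real_normed_vector"
  assumes "C11_on UNIV c"
  shows "continuous_on S (velocity c)"
  using C11_velocity(2)[OF assms] by (meson continuous_on_subset lipschitz_on_continuous_on subset_UNIV)

lemma C11_continuous:
  fixes c :: "real \<Rightarrow> 'a::real_normed_vector"
  assumes "C11_on UNIV c"
  shows "continuous_on S c"
  using C11_velocity(1)[OF assms] by (meson continuous_at_imp_continuous_on has_vector_derivative_continuous)

text \<open>The mean value inequality for \<open>c s - s *\<^sub>R w\<close>. The disjunction
  restricts the velocity bound to the parameters between \<open>a\<close> and \<open>b\<close>.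
  Taking \<open>w\<close> to be a velocity compares the curve with its tangent line; taking
  \<open>w = 0\<close> bounds a displacement.\<close>

lemma C11_increment:
  fixes c :: "real \<Rightarrow> 'a::real_normed_vector"
  assumes "C11_on UNIV c" "\<And>s. norm (velocity c s - w) \<le> B \<or> s \<notin> {min a b..max a b}"
  shows "norm (c b - c a - (b - a) *\<^sub>R w) \<le> B * \<bar>b - a\<bar>"
proof -
  let ?S = "{min a b..max a b}"
  have d: "((\<lambda>s. c s - s *\<^sub>R w) has_derivative (\<lambda>h. h *\<^sub>R (velocity c s - w))) (at s within ?S)" for s
  proof -
    have "(c has_derivative (\<lambda>h. h *\<^sub>R velocity c s)) (at s within ?S)"
      using C11_velocity(1)[OF assms(1)] has_derivative_at_withinI unfolding has_vector_derivative_def by blast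
    moreover have "((\<lambda>s. s *\<^sub>R w) has_derivative (\<lambda>h. h *\<^sub>R w)) (at s within ?S)"
      by (auto intro!: derivative_eq_intros)
    ultimately show ?thesis
      unfolding scaleR_diff_right by (rule has_derivative_diff)
  qed
  have "norm ((c b - b *\<^sub>R w) - (c a - a *\<^sub>R w)) \<le> B * norm (b - a)"
  proof (rule differentiable_bound[OF _ d])
    show "onorm (\<lambda>h. h *\<^sub>R (velocity c s - w)) \<le> B" if "s \<in> ?S" for s
    proof (rule onorm_le)
      fix h :: real
      show "norm (h *\<^sub>R (velocity c s - w)) \<le> B * norm h"
        using assms(2)[of s] that by (simp add: mult.commute[of B] mult_left_mono)
    qed
  qed auto
  then show ?thesis by (simp add: algebra_simps)
qed

text \<open>The velocity of a slice is the joint derivative applied to the vector (0, 1), so it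
  inherits a Lipschitz bound in time whose constant does not depend on \<open>s\<close>.\<close>

lemma C11_on_strip:
  fixes \<Gamma> :: "real \<Rightarrow> real \<Rightarrow> 'a::real_normed_vector"
  assumes "C11_on ({a..b} \<times> UNIV) (\<lambda>(t, s). \<Gamma> t s)"
  obtains L where "0 \<le> L"
    "\<And>t t' s. t \<in> {a..b} \<Longrightarrow> t' \<in> {a..b} \<Longrightarrow> norm (velocity (\<Gamma> t') s - velocity (\<Gamma> t) s) \<le> L * \<bar>t' - t\<bar>"
proof -
  from assms obtain f' L where f:
    "\<And>p. p \<in> {a..b} \<times> UNIV \<Longrightarrow> ((\<lambda>(t, s). \<Gamma> t s) has_derivative blinfun_apply (f' p)) (at p within {a..b} \<times> UNIV)"
    and L: "L-lipschitz_on ({a..b} \<times> UNIV) f'"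
    unfolding C11_on_def by blast
  have v: "velocity (\<Gamma> t) s = f' (t, s) (0, 1)" if t: "t \<in> {a..b}" for t s
  proof -
    have "(Pair t has_derivative Pair 0) (at s)"
      by (auto intro!: derivative_eq_intros)
    moreover have "((\<lambda>(t, s). \<Gamma> t s) has_derivative blinfun_apply (f' (t, s))) (at (t, s) within range (Pair t))"
      by (rule has_derivative_subset[OF f]) (use t in auto)
    ultimately have d: "((\<lambda>s. (\<lambda>(t, s). \<Gamma> t s) (t, s)) has_derivative (\<lambda>h. f' (t, s) (0, h))) (at s)"
      by (rule has_derivative_in_compose)
    have e: "(\<lambda>h. f' (t, s) (0, h)) = (\<lambda>h. h *\<^sub>R f' (t, s) (0, 1))"
    proof
      show "f' (t, s) (0, h) = h *\<^sub>R f' (t, s) (0, 1)" for h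
        using blinfun.scaleR_right[of "f' (t, s)" h "(0, 1)"] by simp
    qed
    have "(\<Gamma> t has_vector_derivative f' (t, s) (0, 1)) (at s)"
      using d[unfolded e] by (simp only: has_vector_derivative_def split_conv)
    then show ?thesis unfolding velocity_def by (rule vector_derivative_at)
  qed
  show thesis
  proof (rule that[OF lipschitz_on_nonneg[OF L]])
    fix t t' s assume t: "t \<in> {a..b}" "t' \<in> {a..b}"
    have "norm (velocity (\<Gamma> t') s - velocity (\<Gamma> t) s) = norm ((f' (t', s) - f' (t, s)) (0, 1))"
      using t by (simp add: v blinfun.diff_left)
    also have "\<dots> \<le> norm (f' (t', s) - f' (t, s))"
      using norm_blinfun[of "f' (t', s) - f' (t, s)" "(0, 1)"] by (simp add: norm_Pair)
    also have "\<dots> \<le> L * \<bar>t' - t\<bar>"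
      using lipschitz_onD[OF L, of "(t', s)" "(t, s)"] t by (simp add: dist_Pair_Pair dist_norm)
    finally show "norm (velocity (\<Gamma> t') s - velocity (\<Gamma> t) s) \<le> L * \<bar>t' - t\<bar>" .
  qed
qed

text \<open>If \<open>t\<close> is a break of the subdivision, no single C11 piece surrounds it. The
  pieces to the left and to the right each give a Lipschitz constant for the comparison with time
  \<open>t\<close>, and the larger one serves both sides.\<close>

lemma piecewise_C11_near:
  assumes "piecewise_C11 \<Gamma>" "t \<in> {0..1}"
  obtains L d where "0 \<le> L" "0 < d"
    "\<And>t' s. t' \<in> {0..1} \<Longrightarrow> \<bar>t' - t\<bar> \<le> d \<Longrightarrow> norm (velocity (\<Gamma> t') s - velocity (\<Gamma> t) s) \<le> L * \<bar>t' - t\<bar>"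
proof -
  from assms obtain I where I: "finite I"
    "\<And>a b. 0 \<le> a \<Longrightarrow> a < b \<Longrightarrow> b \<le> 1 \<Longrightarrow> {a<..<b} \<inter> I = {} \<Longrightarrow> C11_on ({a..b} \<times> UNIV) (\<lambda>(t, s). \<Gamma> t s)"
    unfolding piecewise_C11_def by blast
  \<comment> \<open>Within distance \<open>d\<close> of \<open>t\<close> the only possible break is
    \<open>t\<close> itself, so the open intervals on either side contain none.\<close>
  from finite_set_avoid[OF I(1)] obtain d where d: "0 < d" "\<And>x. x \<in> I \<Longrightarrow> x \<noteq> t \<Longrightarrow> d \<le> dist t x"
    by metis
  let ?near = "\<lambda>L t'. \<forall>s. norm (velocity (\<Gamma> t') s - velocity (\<Gamma> t) s) \<le> L * \<bar>t' - t\<bar>"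
  have right: "\<exists>L\<ge>0. \<forall>t'\<in>{t..min (t + d) 1}. ?near L t'"
  proof (cases "t < 1")
    case True
    have "C11_on ({t..min (t + d) 1} \<times> UNIV) (\<lambda>(t, s). \<Gamma> t s)"
    proof (rule I(2))
      show "{t<..<min (t + d) 1} \<inter> I = {}" using d(2) by (force simp: dist_real_def)
    qed (use assms(2) True d(1) in auto)
    then obtain L where "0 \<le> L" and L: "\<And>r t' s. r \<in> {t..min (t + d) 1} \<Longrightarrow> t' \<in> {t..min (t + d) 1} \<Longrightarrow>
        norm (velocity (\<Gamma> t') s - velocity (\<Gamma> r) s) \<le> L * \<bar>t' - r\<bar>"
      by (rule C11_on_strip) blast
    moreover have "t \<in> {t..min (t + d) 1}" using True d(1) by simp
    ultimately show ?thesis by blast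
  next
    case False
    then have "{t..min (t + d) 1} = {t}" using assms(2) d(1) by auto
    then show ?thesis by (intro exI[of _ 0]) simp
  qed
  have left: "\<exists>L\<ge>0. \<forall>t'\<in>{max (t - d) 0..t}. ?near L t'"
  proof (cases "0 < t")
    case True
    have "C11_on ({max (t - d) 0..t} \<times> UNIV) (\<lambda>(t, s). \<Gamma> t s)"
    proof (rule I(2))
      show "{max (t - d) 0<..<t} \<inter> I = {}" using d(2) by (force simp: dist_real_def)
    qed (use assms(2) True d(1) in auto)
    then obtain L where "0 \<le> L" and L: "\<And>r t' s. r \<in> {max (t - d) 0..t} \<Longrightarrow> t' \<in> {max (t - d) 0..t} \<Longrightarrow>
        norm (velocity (\<Gamma> t') s - velocity (\<Gamma> r) s) \<le> L * \<bar>t' - r\<bar>"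
      by (rule C11_on_strip) blast
    moreover have "t \<in> {max (t - d) 0..t}" using True d(1) by simp
    ultimately show ?thesis by blast
  next
    case False
    then have "{max (t - d) 0..t} = {t}" using assms(2) d(1) by auto
    then show ?thesis by (intro exI[of _ 0]) simp
  qed
  from left right obtain L R where LR: "0 \<le> L" "0 \<le> R"
    "\<forall>t'\<in>{max (t - d) 0..t}. ?near L t'" "\<forall>t'\<in>{t..min (t + d) 1}. ?near R t'" by blast
  show thesis
  proof (rule that[of "max L R" d])
    fix t' s assume t': "t' \<in> {0..1}" "\<bar>t' - t\<bar> \<le> d"
    then have "t' \<in> {max (t - d) 0..t} \<or> t' \<in> {t..min (t + d) 1}" by auto
    then obtain M where M: "M \<le> max L R" "norm (velocity (\<Gamma> t') s - velocity (\<Gamma> t) s) \<le> M * \<bar>t' - t\<bar>"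
      using LR by (metis max.cobounded1 max.cobounded2)
    then show "norm (velocity (\<Gamma> t') s - velocity (\<Gamma> t) s) \<le> max L R * \<bar>t' - t\<bar>"
      by (meson abs_ge_zero mult_right_mono order_trans)
  qed (use LR d in auto)
qed

lemma velocity_norm_integrable:
  assumes "C11_on UNIV \<gamma>"
  shows "(\<lambda>s. norm (velocity \<gamma> s)) integrable_on {a..b::real}"
  by (intro integrable_continuous_real continuous_on_norm C11_velocity_continuous assms)

text \<open>The supremum in \<open>cube_level\<close> is taken over the reals and bounds its members
  only if the lengths are bounded. This follows from continuity of the length on the compact time
  interval.\<close>

lemma len_bdd_above:
  assumes "piecewise_C11 \<Gamma>" "\<And>t. t \<in> {0..1} \<Longrightarrow> C11_on UNIV (\<Gamma> t)"
  shows "bdd_above ((\<lambda>t. len (\<Gamma> t)) ` {0..1})"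
proof -
  have "continuous_on {0..1} (\<lambda>t. len (\<Gamma> t))"
    unfolding continuous_on_iff
  proof (intro ballI allI impI)
    fix t e :: real assume t: "t \<in> {0..1}" and e: "0 < e"
    from piecewise_C11_near[OF assms(1) t] obtain L d where Ld: "0 \<le> L" "0 < d"
      "\<And>t' s. t' \<in> {0..1} \<Longrightarrow> \<bar>t' - t\<bar> \<le> d \<Longrightarrow> norm (velocity (\<Gamma> t') s - velocity (\<Gamma> t) s) \<le> L * \<bar>t' - t\<bar>"
      by metis
    show "\<exists>d>0. \<forall>t'\<in>{0..1}. dist t' t < d \<longrightarrow> dist (len (\<Gamma> t')) (len (\<Gamma> t)) < e"
    proof (intro exI[of _ "min d (e / (L + 1))"] conjI ballI impI)
      show "0 < min d (e / (L + 1))" using Ld e by simp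
      fix t' assume t': "t' \<in> {0..1}" "dist t' t < min d (e / (L + 1))"
      have "len (\<Gamma> t') - len (\<Gamma> t) = integral {0..1} (\<lambda>s. norm (velocity (\<Gamma> t') s) - norm (velocity (\<Gamma> t) s))"
        unfolding len_def by (intro integral_diff[symmetric] velocity_norm_integrable assms(2) t t'(1))
      moreover have "norm (integral {0..1} (\<lambda>s. norm (velocity (\<Gamma> t') s) - norm (velocity (\<Gamma> t) s))) \<le> L * \<bar>t' - t\<bar> * (1 - 0)"
      proof (rule integral_bound)
        show "continuous_on {0..1} (\<lambda>s. norm (velocity (\<Gamma> t') s) - norm (velocity (\<Gamma> t) s))"
          by (intro continuous_intros C11_velocity_continuous assms(2) t t'(1))
        show "norm (norm (velocity (\<Gamma> t') s) - norm (velocity (\<Gamma> t) s)) \<le> L * \<bar>t' - t\<bar>" for s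
          using Ld(3)[OF t'(1), of s] t'(2) norm_triangle_ineq3[of "velocity (\<Gamma> t') s" "velocity (\<Gamma> t) s"]
          by (simp add: dist_real_def)
      qed auto
      ultimately have "dist (len (\<Gamma> t')) (len (\<Gamma> t)) \<le> L * dist t' t" by (simp add: dist_real_def)
      also have "\<dots> \<le> (L + 1) * dist t' t" by (intro mult_right_mono) auto
      also have "\<dots> < e" using t'(2) Ld by (simp add: field_simps)
      finally show "dist (len (\<Gamma> t')) (len (\<Gamma> t)) < e" .
    qed
  qed
  then show ?thesis
    by (intro bounded_imp_bdd_above compact_imp_bounded compact_continuous_image) auto
qed


section \<open>Embedded closed curves\<close>

lemma C11_embeddingD:
  assumes "C11_embedding \<gamma>"
  shows "\<gamma> (s + 1) = \<gamma> s" "C11_on UNIV \<gamma>" "velocity \<gamma> s \<noteq> 0" "inj_on \<gamma> {0..<1}"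
  using assms unfolding C11_embedding_def by auto

lemma periodic_of_int:
  fixes f :: "real \<Rightarrow> 'a"
  assumes "\<And>s. f (s + 1) = f s"
  shows "f (s + of_int n) = f s"
proof (induction n rule: int_induct[where k = 0])
  case (step1 i)
  then show ?case using assms[of "s + of_int i"] by (simp add: add.assoc)
next
  case (step2 i)
  then show ?case using assms[of "s + of_int (i - 1)"] by (simp add: algebra_simps)
qed simp

lemma periodic_frac:
  fixes f :: "real \<Rightarrow> 'a"
  assumes "\<And>s. f (s + 1) = f s"
  shows "f (frac s) = f s"
  using periodic_of_int[of f "frac s" "\<lfloor>s\<rfloor>", OF assms] by (simp add: frac_def)

lemma range_periodic:
  fixes f :: "real \<Rightarrow> 'a"
  assumes "\<And>s. f (s + 1) = f s"
  shows "range f = f ` {0..1}"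
proof -
  have "f s \<in> f ` {0..1}" for s
    using periodic_frac[of f s, OF assms] frac_lt_1[of s]
    by (metis atLeastAtMost_iff frac_ge_0 imageI less_imp_le)
  then show ?thesis by auto
qed

lemma velocity_periodic:
  assumes "\<And>s. f (s + 1) = f s"
  shows "velocity f (s + 1) = velocity f s"
proof -
  have shift: "(f has_vector_derivative d) (at s)" if "(f has_vector_derivative d) (at (s + a))" "f \<circ> (\<lambda>x. x + a) = f" for a s d
  proof -
    have "((\<lambda>x. x + a) has_vector_derivative 1) (at s)"
      by (auto intro!: derivative_eq_intros simp flip: has_real_derivative_iff_has_vector_derivative)
    from vector_diff_chain_at[OF this, of f d] that show ?thesis by simp
  qed
  have "f (x - 1) = f x" for x using assms[of "x - 1"] by simp
  then have *: "(f has_vector_derivative d) (at (s + 1)) \<longleftrightarrow> (f has_vector_derivative d) (at s)" for d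
    using shift[of d s 1] shift[of d "s + 1" "- 1"] assms by (auto simp: comp_def)
  show ?thesis unfolding velocity_def vector_derivative_def * ..
qed

lemma C11_embedding_eq_iff:
  assumes "C11_embedding \<gamma>" "\<gamma> s = \<gamma> s'"
  shows "s - s' \<in> \<int>"
proof -
  have "\<gamma> (frac s) = \<gamma> (frac s')"
    using assms periodic_frac[of \<gamma>] C11_embeddingD(1) by metis
  then have "frac s = frac s'"
    using C11_embeddingD(4)[OF assms(1)] by (auto dest!: inj_onD simp: frac_lt_1)
  then have "s - s' = of_int (\<lfloor>s\<rfloor> - \<lfloor>s'\<rfloor>)" by (simp add: frac_def)
  then show ?thesis by (metis Ints_of_int)
qed

lemma compact_range_C11_embedding:
  assumes "C11_embedding \<gamma>"
  shows "compact (range \<gamma>)"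
  using range_periodic[of \<gamma>] C11_embeddingD[OF assms]
  by (simp add: C11_continuous compact_continuous_image)

lemma speed_lower_bound:
  assumes "C11_embedding \<gamma>"
  obtains c where "0 < c" "\<And>s. c \<le> norm (velocity \<gamma> s)"
proof -
  note E = C11_embeddingD[OF assms]
  have "continuous_on {0..1} (\<lambda>s. norm (velocity \<gamma> s))"
    by (intro continuous_on_norm C11_velocity_continuous E)
  then obtain x where x: "\<forall>y\<in>{0..1}. norm (velocity \<gamma> x) \<le> norm (velocity \<gamma> y)"
    using continuous_attains_inf[of "{0..1::real}" "\<lambda>s. norm (velocity \<gamma> s)"] by auto
  show thesis
  proof (rule that[of "norm (velocity \<gamma> x)"])
    fix s
    have "velocity \<gamma> (frac s) = velocity \<gamma> s"
      by (intro periodic_frac velocity_periodic E(1))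
    then show "norm (velocity \<gamma> x) \<le> norm (velocity \<gamma> s)"
      using x frac_lt_1[of s] by (metis atLeastAtMost_iff frac_ge_0 less_imp_le)
  qed (use E(3) in simp)
qed

text \<open>For parameters at most 1/2 apart, \<open>\<bar>s - s'\<bar>\<close> is the distance on
  the circle. Very close parameters are handled by comparison with the tangent line, the others by
  compactness and injectivity.\<close>

lemma chord_arc:
  assumes "C11_embedding \<gamma>"
  obtains c where "0 < c" "\<And>s s'. \<bar>s - s'\<bar> \<le> 1 / 2 \<Longrightarrow> c * \<bar>s - s'\<bar> \<le> norm (\<gamma> s - \<gamma> s')"
proof -
  note E = C11_embeddingD[OF assms]
  obtain m where m: "0 < m" "\<And>s. m \<le> norm (velocity \<gamma> s)"
    using speed_lower_bound[OF assms] by metis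
  from C11_velocity(2)[OF E(2)] obtain L where L: "L-lipschitz_on UNIV (velocity \<gamma>)" ..
  then have L0: "0 \<le> L" by (rule lipschitz_on_nonneg)
  \<comment> \<open>On an interval of this length the velocity varies by at most
    \<open>m / 2\<close>, half the minimal speed \<open>m\<close>, so the other half remains for the
    chord. Using \<open>L + 1\<close> avoids a zero denominator.\<close>
  define h where "h = m / (2 * (L + 1))"
  have h: "0 < h" unfolding h_def using m L0 by simp
  have short: "m / 2 * \<bar>s - s'\<bar> \<le> norm (\<gamma> s - \<gamma> s')" if "\<bar>s - s'\<bar> \<le> h" for s s'
  proof -
    have "norm (\<gamma> s - \<gamma> s' - (s - s') *\<^sub>R velocity \<gamma> s') \<le> m / 2 * \<bar>s - s'\<bar>"
    proof (rule C11_increment[OF E(2)])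
      fix r
      show "norm (velocity \<gamma> r - velocity \<gamma> s') \<le> m / 2 \<or> r \<notin> {min s' s..max s' s}"
      proof (cases "r \<in> {min s' s..max s' s}")
        case True
        then have "dist r s' \<le> h" using that by (auto simp: dist_real_def)
        then have "L * dist r s' \<le> (L + 1) * h" using L0 by (intro mult_mono) auto
        also have "\<dots> = m / 2" unfolding h_def using L0 by (simp add: field_simps)
        finally show ?thesis using lipschitz_onD[OF L, of r s'] by (simp add: dist_norm)
      qed simp
    qed
    moreover have "m * \<bar>s - s'\<bar> \<le> norm ((s - s') *\<^sub>R velocity \<gamma> s')"
      using mult_left_mono[OF m(2)[of s'], of "\<bar>s - s'\<bar>"] by (simp add: mult.commute)
    moreover have "norm ((s - s') *\<^sub>R velocity \<gamma> s') \<le> norm (\<gamma> s - \<gamma> s') + norm (\<gamma> s - \<gamma> s' - (s - s') *\<^sub>R velocity \<gamma> s')"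
      by (metis norm_minus_commute norm_triangle_sub)
    ultimately show ?thesis by linarith
  qed
  \<comment> \<open>The compact set of pairs that are not very close. Differences in it lie strictly
    between 0 and 1 in absolute value, so no pair names the same point of the circle.\<close>
  define P where "P = ({0..1} \<times> {-1..2}) \<inter> {p :: real \<times> real. h \<le> \<bar>fst p - snd p\<bar>} \<inter> {p. \<bar>fst p - snd p\<bar> \<le> 1 / 2}"
  have "compact P" unfolding P_def
    by (intro compact_Int_closed compact_Times closed_Collect_le continuous_intros) auto
  have cont: "continuous_on P (\<lambda>p. norm (\<gamma> (fst p) - \<gamma> (snd p)))"
    by (intro continuous_intros continuous_on_compose2[OF C11_continuous[OF E(2), of UNIV]]) auto
  have pos: "0 < norm (\<gamma> (fst p) - \<gamma> (snd p))" if "p \<in> P" for p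
  proof (rule ccontr)
    assume "\<not> ?thesis"
    then have "fst p - snd p \<in> \<int>" using C11_embedding_eq_iff[OF assms] by simp
    then obtain n where "fst p - snd p = of_int n" by (auto elim: Ints_cases)
    then have "0 < real_of_int \<bar>n\<bar>" "real_of_int \<bar>n\<bar> < 1" using that h unfolding P_def by auto
    then have "0 < \<bar>n\<bar>" "\<bar>n\<bar> < 1" by (simp_all only: of_int_0_less_iff of_int_less_1_iff)
    then show False by linarith
  qed
  obtain e where e: "0 < e" "\<And>p. p \<in> P \<Longrightarrow> e \<le> norm (\<gamma> (fst p) - \<gamma> (snd p))"
  proof (cases "P = {}")
    case False
    from continuous_attains_inf[OF \<open>compact P\<close> False cont] pos that show ?thesis by blast
  qed (use that[of 1] in auto)
  show thesis
  proof (rule that[of "min (m / 2) e"])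
    show "0 < min (m / 2) e" using m e by simp
    fix s s' :: real assume a: "\<bar>s - s'\<bar> \<le> 1 / 2"
    show "min (m / 2) e * \<bar>s - s'\<bar> \<le> norm (\<gamma> s - \<gamma> s')"
    proof (cases "\<bar>s - s'\<bar> \<le> h")
      case True
      have "min (m / 2) e * \<bar>s - s'\<bar> \<le> m / 2 * \<bar>s - s'\<bar>" by (intro mult_right_mono) auto
      with short[OF True] show ?thesis by linarith
    next
      case False
      \<comment> \<open>The integer shift that brings \<open>s\<close> into the unit interval;
        \<open>s'\<close> then lies within 1/2 of that interval, hence between -1 and 2.\<close>
      let ?n = "- \<lfloor>s\<rfloor>"
      have "0 \<le> s + of_int ?n" "s + of_int ?n \<le> 1" by linarith+
      moreover have "- 1 \<le> s' + of_int ?n" "s' + of_int ?n \<le> 2" using a by linarith+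
      ultimately have "(s + of_int ?n, s' + of_int ?n) \<in> P" using a False unfolding P_def by auto
      from e(2)[OF this] have "e \<le> norm (\<gamma> s - \<gamma> s')"
        using periodic_of_int[of \<gamma>, OF E(1)] by (simp del: of_int_minus)
      moreover have "min (m / 2) e * \<bar>s - s'\<bar> \<le> e * 1" using a e(1) by (intro mult_mono) auto
      ultimately show ?thesis by linarith
    qed
  qed
qed


section \<open>Knot types along movies\<close>

text \<open>Time is run backwards after applying the inverse \<open>G\<close> of \<open>H 1\<close>:
  at time 0 this gives \<open>H 1 (G x) = x\<close>, and at time 1 it gives
  \<open>G x\<close>.\<close>

lemma ambient_isotopy_reverse:
  assumes "ambient_isotopy UNIV H"
  obtains H' where "ambient_isotopy UNIV H'" "\<And>x. H' 1 (H 1 x) = x"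
proof -
  from assms have c: "continuous_on ({0..1} \<times> UNIV) (\<lambda>(t, x). H t x)"
    and h: "\<forall>t\<in>{0..1}. \<exists>G. homeomorphism UNIV UNIV (H t) G" and 0: "\<And>x. H 0 x = x"
    unfolding ambient_isotopy_def by auto
  from h obtain G where G: "homeomorphism UNIV UNIV (H 1) G" by force
  define H' where "H' = (\<lambda>t x. H (1 - t) (G x))"
  have "ambient_isotopy UNIV H'"
    unfolding ambient_isotopy_def
  proof (intro conjI ballI)
    have "continuous_on ({0..1} \<times> UNIV) (\<lambda>p. (\<lambda>(t, x). H t x) (1 - fst p, G (snd p)))"
      by (rule continuous_on_compose2[OF c])
        (use homeomorphism_cont2[OF G] in \<open>auto intro!: continuous_intros intro: continuous_on_compose2[of UNIV G]\<close>)
    then show "continuous_on ({0..1} \<times> UNIV) (\<lambda>(t, x). H' t x)"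
      unfolding H'_def by (simp add: split_def)
    show "\<exists>K. homeomorphism UNIV UNIV (H' t) K" if "t \<in> {0..1}" for t
    proof -
      from h that obtain K where "homeomorphism UNIV UNIV (H (1 - t)) K" by (metis atLeastAtMost_iff diff_ge_0_iff_ge diff_left_mono diff_zero le_diff_eq add_0)
      from homeomorphism_compose[OF homeomorphism_symD[OF G] this] show ?thesis
        unfolding H'_def comp_def by blast
    qed
    show "H' 0 x = x" for x unfolding H'_def using G by (simp add: homeomorphism_def)
  qed
  moreover have "H' 1 (H 1 x) = x" for x
    unfolding H'_def using G 0 by (simp add: homeomorphism_def)
  ultimately show thesis using that by blast
qed

lemma ambient_isotopy_compose:
  assumes "ambient_isotopy UNIV H" "ambient_isotopy UNIV H'"
  shows "ambient_isotopy UNIV (\<lambda>t x. H' t (H t x))"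
  unfolding ambient_isotopy_def
proof (intro conjI ballI)
  from assms have c: "continuous_on ({0..1} \<times> UNIV) (\<lambda>(t, x). H t x)"
    "continuous_on ({0..1} \<times> UNIV) (\<lambda>(t, x). H' t x)"
    unfolding ambient_isotopy_def by auto
  have "continuous_on ({0..1} \<times> UNIV) (\<lambda>p. (\<lambda>(t, x). H' t x) (fst p, H (fst p) (snd p)))"
    by (rule continuous_on_compose2[OF c(2)])
      (use c(1) in \<open>auto simp: split_def intro!: continuous_intros\<close>)
  then show "continuous_on ({0..1} \<times> UNIV) (\<lambda>(t, x). H' t (H t x))"
    by (simp add: split_def)
  show "\<exists>K. homeomorphism UNIV UNIV (\<lambda>x. H' t (H t x)) K" if "t \<in> {0..1}" for t
  proof -
    from assms that obtain F F' where
      "homeomorphism UNIV UNIV (H t) F" "homeomorphism UNIV UNIV (H' t) F'"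
      unfolding ambient_isotopy_def by blast
    from homeomorphism_compose[OF this] show ?thesis unfolding comp_def by blast
  qed
  show "H' 0 (H 0 x) = x" for x using assms unfolding ambient_isotopy_def by simp
qed

text \<open>A knot type is an orbit under end maps of ambient isotopies. Composition gives one
  direction of the equivalence and reversal the other.\<close>

lemma knot_type_image:
  assumes "knot_type K" "ambient_isotopy UNIV H"
  shows "H 1 ` C \<in> K \<longleftrightarrow> C \<in> K"
proof -
  have *: "H 1 ` C \<in> K" if "C \<in> K" "ambient_isotopy UNIV H" for C and H :: "real \<Rightarrow> real^3 \<Rightarrow> real^3"
  proof -
    from assms(1) obtain P where K: "K = {C'. \<exists>H. ambient_isotopy UNIV H \<and> C' = H 1 ` P}"
      unfolding knot_type_def by blast
    with that obtain J where "ambient_isotopy UNIV J" "C = J 1 ` P" by blast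
    with ambient_isotopy_compose[OF this(1) that(2)] show ?thesis
      unfolding K by (auto simp: image_image intro!: exI[of _ "\<lambda>t x. H t (J t x)"])
  qed
  obtain H' where H': "ambient_isotopy UNIV H'" "\<And>x. H' 1 (H 1 x) = x"
    using ambient_isotopy_reverse[OF assms(2)] by metis
  have "H' 1 ` H 1 ` C = C" by (simp add: image_image H'(2))
  with *[OF _ assms(2)] *[OF _ H'(1)] show ?thesis by metis
qed

text \<open>Subtracting the contraction shows that the map shrinks distances by a factor of at least
  \<open>1 - L\<close>, which gives injectivity and a Lipschitz inverse. A preimage of
  \<open>y\<close> is a fixed point of the contraction
  \<open>\<lambda>x. y - \<psi> x\<close>.\<close>

lemma homeomorphism_id_plus_contraction:
  fixes \<psi> :: "'a::{real_normed_vector, complete_space} \<Rightarrow> 'a"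
  assumes "L-lipschitz_on UNIV \<psi>" "L < 1"
  shows "\<exists>G. homeomorphism UNIV UNIV (\<lambda>x. x + \<psi> x) G"
proof -
  let ?h = "\<lambda>x. x + \<psi> x"
  have L0: "0 \<le> L" using assms(1) by (rule lipschitz_on_nonneg)
  have exp: "(1 - L) * dist x y \<le> dist (?h x) (?h y)" for x y
  proof -
    have "dist x y = norm ((?h x - ?h y) - (\<psi> x - \<psi> y))" by (simp add: dist_norm)
    also have "\<dots> \<le> dist (?h x) (?h y) + dist (\<psi> x) (\<psi> y)"
      unfolding dist_norm by (rule norm_triangle_ineq4)
    also have "\<dots> \<le> dist (?h x) (?h y) + L * dist x y"
      using lipschitz_onD[OF assms(1), of x y] by simp
    finally show ?thesis by (simp add: algebra_simps)
  qed
  have inj: "inj ?h"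
  proof (rule injI)
    fix x y assume "?h x = ?h y"
    then have "(1 - L) * dist x y \<le> 0" using exp[of x y] by simp
    with assms(2) show "x = y" by (simp add: mult_le_0_iff)
  qed
  have surj: "surj ?h"
    unfolding surj_def
  proof
    fix y
    have "\<exists>!x. y - \<psi> x = x"
      using banach_fix_type[OF L0 assms(2), of "\<lambda>x. y - \<psi> x"] lipschitz_onD[OF assms(1)]
      by (simp add: dist_norm norm_minus_commute)
    then show "\<exists>x. y = ?h x" by (metis diff_add_cancel add.commute)
  qed
  have "homeomorphism UNIV UNIV ?h (inv ?h)"
  proof (rule homeomorphismI)
    show "continuous_on UNIV ?h"
      using lipschitz_on_continuous_on[OF assms(1)] by (intro continuous_intros)
    have "(1 / (1 - L))-lipschitz_on UNIV (inv ?h)"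
    proof (rule lipschitz_onI)
      fix x y
      show "dist (inv ?h x) (inv ?h y) \<le> 1 / (1 - L) * dist x y"
        using exp[of "inv ?h x" "inv ?h y"] assms(2)
        by (simp add: surj_f_inv_f[OF surj] field_simps)
    qed (use assms(2) in simp)
    then show "continuous_on UNIV (inv ?h)" by (rule lipschitz_on_continuous_on)
  qed (auto simp: inv_f_f[OF inj] surj_f_inv_f[OF surj])
  then show "\<exists>G. homeomorphism UNIV UNIV (\<lambda>x. x + \<psi> x) G"
    by (intro exI[of _ "inv ?h"])
qed

lemma ambient_isotopy_id_plus_contraction:
  fixes \<psi> :: "'a::{real_normed_vector, complete_space} \<Rightarrow> 'a"
  assumes "L-lipschitz_on UNIV \<psi>" "L < 1"
  shows "ambient_isotopy UNIV (\<lambda>t x. x + t *\<^sub>R \<psi> x)"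
  unfolding ambient_isotopy_def
proof (intro conjI ballI)
  have "continuous_on S \<psi>" for S
    using lipschitz_on_continuous_on[OF assms(1)] continuous_on_subset by blast
  then have "continuous_on ({0..1 :: real} \<times> UNIV) (\<lambda>p. \<psi> (snd p))"
    by (rule continuous_on_compose2[where t = UNIV]) (auto intro: continuous_on_snd continuous_on_id)
  then show "continuous_on ({0..1} \<times> UNIV) (\<lambda>(t, x). x + t *\<^sub>R \<psi> x)"
    unfolding split_def by (intro continuous_intros)
  show "\<exists>G. homeomorphism UNIV UNIV (\<lambda>x. x + t *\<^sub>R \<psi> x) G" if "t \<in> {0..1}" for t
  proof (rule homeomorphism_id_plus_contraction)
    show "L-lipschitz_on UNIV (\<lambda>x. t *\<^sub>R \<psi> x)"
    proof (rule lipschitz_onI)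
      fix x y
      have "dist (t *\<^sub>R \<psi> x) (t *\<^sub>R \<psi> y) = t * dist (\<psi> x) (\<psi> y)"
        using that by (simp add: dist_norm flip: scaleR_diff_right)
      also have "\<dots> \<le> 1 * dist (\<psi> x) (\<psi> y)" using that by (intro mult_right_mono) auto
      finally show "dist (t *\<^sub>R \<psi> x) (t *\<^sub>R \<psi> y) \<le> L * dist x y"
        using lipschitz_onD[OF assms(1), of x y] by simp
    qed (rule lipschitz_on_nonneg[OF assms(1)])
  qed fact
qed simp

text \<open>McShane's formula; applied to each coordinate in the vector-valued case.\<close>

lemma lipschitz_extension_real:
  fixes f :: "'a::metric_space \<Rightarrow> real"
  assumes "L-lipschitz_on C f"
  obtains g where "L-lipschitz_on UNIV g" "\<And>x. x \<in> C \<Longrightarrow> g x = f x"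
proof (cases "C = {}")
  case True
  show thesis
  proof (rule that[of "\<lambda>x. 0"])
    show "L-lipschitz_on UNIV (\<lambda>x. 0 :: real)"
      using lipschitz_on_nonneg[OF assms] by (auto intro: lipschitz_onI)
  qed (use True in simp)
next
  case False
  then obtain c where c: "c \<in> C" by blast
  have L0: "0 \<le> L" using assms by (rule lipschitz_on_nonneg)
  define g where "g = (\<lambda>x. INF a\<in>C. f a + L * dist x a)"
  have low: "f b - L * dist x b \<le> f a + L * dist x a" if "a \<in> C" "b \<in> C" for a b x
  proof -
    have "f b - f a \<le> L * dist b a" using lipschitz_onD[OF assms that(2,1)] by (simp add: dist_real_def)
    also have "\<dots> \<le> L * (dist x b + dist x a)"
      using L0 by (intro mult_left_mono) (metis dist_commute dist_triangle)
    finally show ?thesis by (simp add: algebra_simps)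
  qed
  have bdd: "bdd_below ((\<lambda>a. f a + L * dist x a) ` C)" for x
    using low[OF _ c] by (intro bdd_belowI2)
  have le: "g x \<le> g y + L * dist x y" for x y
  proof -
    have "g x - L * dist x y \<le> f a + L * dist y a" if "a \<in> C" for a
    proof -
      have "g x \<le> f a + L * dist x a" unfolding g_def by (rule cINF_lower[OF bdd that])
      also have "L * dist x a \<le> L * (dist x y + dist y a)"
        using L0 by (intro mult_left_mono dist_triangle)
      finally show ?thesis by (simp add: algebra_simps)
    qed
    then have "g x - L * dist x y \<le> g y" unfolding g_def using False by (intro cINF_greatest)
    then show ?thesis by simp
  qed
  show thesis
  proof (rule that[of g])
    show "L-lipschitz_on UNIV g"
    proof (rule lipschitz_onI)
      fix x y
      show "dist (g x) (g y) \<le> L * dist x y"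
        using le[of x y] le[of y x] by (simp add: dist_real_def dist_commute abs_le_iff)
    qed (rule L0)
    fix x assume x: "x \<in> C"
    have "g x \<le> f x" using cINF_lower[OF bdd x, of x] unfolding g_def by simp
    moreover have "f x \<le> g x" unfolding g_def
      using low[OF _ x, of _ x] False by (intro cINF_greatest) auto
    ultimately show "g x = f x" by simp
  qed
qed

lemma lipschitz_extension:
  fixes f :: "'a::metric_space \<Rightarrow> 'b::euclidean_space"
  assumes "L-lipschitz_on C f"
  obtains g where "(real DIM('b) * L)-lipschitz_on UNIV g" "\<And>x. x \<in> C \<Longrightarrow> g x = f x"
proof -
  have L0: "0 \<le> L" using assms by (rule lipschitz_on_nonneg)
  have "\<exists>h. L-lipschitz_on UNIV h \<and> (\<forall>x\<in>C. h x = f x \<bullet> b)" if "b \<in> Basis" for b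
  proof -
    have "L-lipschitz_on C (\<lambda>x. f x \<bullet> b)"
    proof (rule lipschitz_onI)
      fix x y assume "x \<in> C" "y \<in> C"
      have "dist (f x \<bullet> b) (f y \<bullet> b) \<le> dist (f x) (f y)"
        using Basis_le_norm[OF that, of "f x - f y"] by (simp add: dist_norm inner_diff_left)
      also have "\<dots> \<le> L * dist x y" by (rule lipschitz_onD[OF assms]) fact+
      finally show "dist (f x \<bullet> b) (f y \<bullet> b) \<le> L * dist x y" .
    qed (rule L0)
    then obtain g where "L-lipschitz_on UNIV g" "\<And>x. x \<in> C \<Longrightarrow> g x = f x \<bullet> b"
      by (rule lipschitz_extension_real) blast
    then show ?thesis by blast
  qed
  then obtain h where h: "\<And>b. b \<in> Basis \<Longrightarrow> L-lipschitz_on UNIV (h b)"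
    "\<And>b x. b \<in> Basis \<Longrightarrow> x \<in> C \<Longrightarrow> h b x = f x \<bullet> b" by metis
  show thesis
  proof (rule that[of "\<lambda>x. \<Sum>b\<in>Basis. h b x *\<^sub>R b"])
    show "(real DIM('b) * L)-lipschitz_on UNIV (\<lambda>x. \<Sum>b\<in>Basis. h b x *\<^sub>R b)"
    proof (rule lipschitz_onI)
      fix x y
      have "dist (\<Sum>b\<in>Basis. h b x *\<^sub>R b) (\<Sum>b\<in>Basis. h b y *\<^sub>R b)
          = norm (\<Sum>b\<in>Basis. (h b x - h b y) *\<^sub>R (b :: 'b))"
        by (simp add: dist_norm sum_subtractf scaleR_diff_left)
      also have "\<dots> \<le> (\<Sum>b\<in>(Basis :: 'b set). L * dist x y)"
      proof (rule sum_norm_le)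
        fix b :: 'b assume b: "b \<in> Basis"
        then show "norm ((h b x - h b y) *\<^sub>R b) \<le> L * dist x y"
          using lipschitz_onD[OF h(1)[OF b], of x y] by (simp add: dist_real_def)
      qed
      finally show "dist (\<Sum>b\<in>Basis. h b x *\<^sub>R b) (\<Sum>b\<in>Basis. h b y *\<^sub>R b) \<le> DIM('b) * L * dist x y"
        by simp
    qed (use L0 in simp)
    show "(\<Sum>b\<in>Basis. h b x *\<^sub>R b) = f x" if "x \<in> C" for x
      using h(2)[OF _ that] by (simp add: euclidean_representation cong: sum.cong)
  qed
qed

text \<open>The constant 1/6 comes from the dimension: extending the displacement coordinate by
  coordinate multiplies its Lipschitz constant by 3, leaving 1/2, which is below the threshold 1 for
  an ambient isotopy.\<close>

lemma knot_type_displacement: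
  assumes "knot_type K"
    and lip: "\<And>s s'. norm ((\<gamma>' s - \<gamma> s) - (\<gamma>' s' - \<gamma> s')) \<le> 1 / 6 * norm (\<gamma> s - \<gamma> s')"
  shows "range \<gamma>' \<in> K \<longleftrightarrow> range \<gamma> \<in> K"
proof -
  \<comment> \<open>The displacement as a function of the point instead of the parameter. The choice
    of the parameter is immaterial, since \<open>lip\<close> forces equal displacements at
    parameters with the same point.\<close>
  define v where "v = (\<lambda>x. let s = SOME s. \<gamma> s = x in \<gamma>' s - \<gamma> s)"
  have v: "v (\<gamma> s) = \<gamma>' s - \<gamma> s" for s
  proof -
    have "\<gamma> (SOME s'. \<gamma> s' = \<gamma> s) = \<gamma> s" by (rule someI) (rule refl)
    with lip[of "SOME s'. \<gamma> s' = \<gamma> s" s] show ?thesis unfolding v_def Let_def by simp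
  qed
  have "(1 / 6)-lipschitz_on (range \<gamma>) v"
    by (rule lipschitz_onI) (use lip in \<open>auto simp: v dist_norm\<close>)
  then obtain g where "(real DIM(real^3) * (1 / 6))-lipschitz_on UNIV g" "\<And>x. x \<in> range \<gamma> \<Longrightarrow> g x = v x"
    by (rule lipschitz_extension) blast
  then have g: "(1 / 2)-lipschitz_on UNIV g" "\<And>s. g (\<gamma> s) = \<gamma>' s - \<gamma> s" using v by auto
  have H: "ambient_isotopy UNIV (\<lambda>t x. x + t *\<^sub>R g x)"
    by (rule ambient_isotopy_id_plus_contraction[OF g(1)]) simp
  have "range \<gamma>' = (\<lambda>x. x + 1 *\<^sub>R g x) ` range \<gamma>" by (simp add: image_image g(2))
  with knot_type_image[OF assms(1) H] show ?thesis by simp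
qed

text \<open>With \<open>c\<close> the chord-arc constant, a velocity difference of at most
  \<open>c / 6\<close> changes the displacement by at most 1/6 of the chord. Velocities suffice
  because only differences of displacements enter.\<close>

lemma knot_type_C1_close:
  assumes "knot_type K" "C11_embedding \<gamma>"
  obtains e where "0 < e"
    "\<And>\<gamma>'. C11_embedding \<gamma>' \<Longrightarrow> (\<And>s. norm (velocity \<gamma>' s - velocity \<gamma> s) \<le> e) \<Longrightarrow> range \<gamma>' \<in> K \<longleftrightarrow> range \<gamma> \<in> K"
proof -
  obtain c where c: "0 < c" "\<And>s s'. \<bar>s - s'\<bar> \<le> 1 / 2 \<Longrightarrow> c * \<bar>s - s'\<bar> \<le> norm (\<gamma> s - \<gamma> s')"
    using chord_arc[OF assms(2)] by metis
  show thesis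
  proof (rule that[of "c / 6"])
    fix \<gamma>' assume \<gamma>': "C11_embedding \<gamma>'" "\<And>s. norm (velocity \<gamma>' s - velocity \<gamma> s) \<le> c / 6"
    note E = C11_embeddingD[OF assms(2)] C11_embeddingD[OF \<gamma>'(1)]
    let ?v = "\<lambda>s. \<gamma>' s - \<gamma> s"
    have vel: "velocity ?v s = velocity \<gamma>' s - velocity \<gamma> s" for s
      unfolding velocity_def[of ?v]
      by (intro vector_derivative_at has_vector_derivative_diff C11_velocity E)
    have close: "norm (?v s - ?v s') \<le> 1 / 6 * norm (\<gamma> s - \<gamma> s')" if "\<bar>s - s'\<bar> \<le> 1 / 2" for s s'
    proof -
      have "norm (?v s - ?v s' - (s - s') *\<^sub>R 0) \<le> c / 6 * \<bar>s - s'\<bar>"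
        by (rule C11_increment[OF C11_on_diff]) (use E \<gamma>'(2) in \<open>auto simp: vel\<close>)
      with c(2)[OF that] show ?thesis by simp
    qed
    show "range \<gamma>' \<in> K \<longleftrightarrow> range \<gamma> \<in> K"
    proof (rule knot_type_displacement[OF assms(1)])
      fix s s' :: real
      \<comment> \<open>By periodicity, one of the two parameters may be shifted by an integer until
        they are at most 1/2 apart, where the chord-arc inequality applies.\<close>
      obtain n where n: "\<bar>s - (s' + of_int n)\<bar> \<le> 1 / 2"
        by (rule that[of "round (s - s')"]) (use of_int_round_abs_le[of "s - s'"] in \<open>simp add: abs_minus_commute algebra_simps\<close>)
      from close[OF n] show "norm (?v s - ?v s') \<le> 1 / 6 * norm (\<gamma> s - \<gamma> s')"
        using periodic_of_int[of \<gamma>, OF E(1)] periodic_of_int[of \<gamma>', OF E(5)] by simp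
    qed
  qed (use c in simp)
qed

text \<open>Slices close in time have uniformly close velocities, so membership in \<open>K\<close>
  is locally constant on the connected time interval.\<close>

lemma knot_type_movie:
  assumes "knot_type K" "piecewise_C11 \<Gamma>" "\<And>t. t \<in> {0..1} \<Longrightarrow> C11_embedding (\<Gamma> t)"
    and "range (\<Gamma> 0) \<in> K" "t \<in> {0..1}"
  shows "range (\<Gamma> t) \<in> K"
proof -
  have "(range (\<Gamma> 0) \<in> K) = (range (\<Gamma> t) \<in> K)"
  proof (rule connected_local_const[of "{0..1}" 0 t "\<lambda>t. range (\<Gamma> t) \<in> K"])
    show "\<forall>a\<in>{0..1}. \<forall>\<^sub>F b in at a within {0..1}. (range (\<Gamma> a) \<in> K) = (range (\<Gamma> b) \<in> K)"
    proof
      fix a :: real assume a: "a \<in> {0..1}"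
      obtain e where e: "0 < e"
        "\<And>\<gamma>'. C11_embedding \<gamma>' \<Longrightarrow> (\<And>s. norm (velocity \<gamma>' s - velocity (\<Gamma> a) s) \<le> e) \<Longrightarrow> range \<gamma>' \<in> K \<longleftrightarrow> range (\<Gamma> a) \<in> K"
        using knot_type_C1_close[OF assms(1) assms(3)[OF a]] by metis
      obtain L d where Ld: "0 \<le> L" "0 < d"
        "\<And>t' s. t' \<in> {0..1} \<Longrightarrow> \<bar>t' - a\<bar> \<le> d \<Longrightarrow> norm (velocity (\<Gamma> t') s - velocity (\<Gamma> a) s) \<le> L * \<bar>t' - a\<bar>"
        using piecewise_C11_near[OF assms(2) a] by metis
      show "\<forall>\<^sub>F b in at a within {0..1}. (range (\<Gamma> a) \<in> K) = (range (\<Gamma> b) \<in> K)"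
        unfolding eventually_at
      proof (intro exI[of _ "min d (e / (L + 1))"] conjI ballI impI)
        show "0 < min d (e / (L + 1))" using Ld e by simp
        fix b assume b: "b \<in> {0..1}" "b \<noteq> a \<and> dist b a < min d (e / (L + 1))"
        have "norm (velocity (\<Gamma> b) s - velocity (\<Gamma> a) s) \<le> e" for s
        proof -
          have "norm (velocity (\<Gamma> b) s - velocity (\<Gamma> a) s) \<le> L * \<bar>b - a\<bar>"
            by (rule Ld) (use b in \<open>auto simp: dist_real_def\<close>)
          also have "\<dots> \<le> (L + 1) * (e / (L + 1))"
            using b Ld(1) by (intro mult_mono) (auto simp: dist_real_def)
          finally show ?thesis using Ld(1) by simp
        qed
        from e(2)[OF assms(3)[OF b(1)] this] show "(range (\<Gamma> a) \<in> K) = (range (\<Gamma> b) \<in> K)" by simp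
      qed
    qed
  qed (use assms(5) in auto)
  with assms(4) show ?thesis by simp
qed


section \<open>Thickness and ropelength\<close>

text \<open>Federer's balls of radius \<open>r\<close> about the points of \<open>A\<close> together
  cover the points at distance less than \<open>r\<close> from \<open>A\<close>; compactness
  supplies the centre as a nearest point. The empty set is excluded because its
  \<open>infdist\<close> is 0 by convention.\<close>

lemma reach_ge_iff:
  fixes A :: "'a::heine_borel set"
  assumes "compact A" "0 < r"
  shows "ereal r \<le> reach A \<longleftrightarrow> (\<forall>x. infdist x A < r \<longrightarrow> A \<noteq> {} \<longrightarrow> x \<in> unique_nearest A)"
proof
  assume r: "ereal r \<le> reach A"
  show "\<forall>x. infdist x A < r \<longrightarrow> A \<noteq> {} \<longrightarrow> x \<in> unique_nearest A"
  proof (intro allI impI)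
    fix x assume x: "infdist x A < r" and ne: "A \<noteq> {}"
    obtain a where a: "a \<in> A" "infdist x A = dist x a"
      using infdist_attains_inf[OF compact_imp_closed[OF assms(1)] ne] by metis
    have "ereal (dist x a) < reach_at A a"
      using x a r unfolding reach_def
      by (metis INF_lower ereal_less_eq(3) less_le_not_le order_less_le_trans order_trans)
    then obtain q where "ball a q \<subseteq> unique_nearest A" "dist x a < q"
      unfolding reach_at_def less_SUP_iff by auto
    then show "x \<in> unique_nearest A" by (auto simp: dist_commute)
  qed
next
  assume U: "\<forall>x. infdist x A < r \<longrightarrow> A \<noteq> {} \<longrightarrow> x \<in> unique_nearest A"
  show "ereal r \<le> reach A"
    unfolding reach_def
  proof (rule INF_greatest)
    fix a assume a: "a \<in> A"
    have "ball a r \<subseteq> unique_nearest A"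
    proof
      fix x assume "x \<in> ball a r"
      then have "infdist x A < r" using infdist_le[OF a, of x] by (simp add: dist_commute)
      then show "x \<in> unique_nearest A" using U a by blast
    qed
    then show "ereal r \<le> reach_at A a"
      unfolding reach_at_def using assms(2) by (intro SUP_upper) auto
  qed
qed

text \<open>For a point \<open>x\<close> at distance less than \<open>r\<close> from
  \<open>A\<close>, all nearest points lie in the open ball of radius \<open>r\<close> about
  \<open>x\<close>. If \<open>A\<close> and \<open>A'\<close> agree there, they have the same
  distance from \<open>x\<close> and the same nearest points. The model \<open>A'\<close> may vary
  with \<open>x\<close>.\<close>

lemma reach_ge_local:
  fixes A :: "'a::heine_borel set"
  assumes "compact A" "0 < r"
    and loc: "\<And>x. \<exists>A'. compact A' \<and> ereal r \<le> reach A' \<and> A \<inter> ball x r = A' \<inter> ball x r"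
  shows "ereal r \<le> reach A"
  unfolding reach_ge_iff[OF assms(1,2)]
proof (intro allI impI)
  fix x assume x: "infdist x A < r" and ne: "A \<noteq> {}"
  from loc obtain A' where A': "compact A'" "ereal r \<le> reach A'" "A \<inter> ball x r = A' \<inter> ball x r" by blast
  have trace: "p \<in> A \<longleftrightarrow> p \<in> A'" if "dist x p < r" for p
    using A'(3) that by (auto simp: set_eq_iff)
  obtain a where a: "a \<in> A" "infdist x A = dist x a"
    using infdist_attains_inf[OF compact_imp_closed[OF assms(1)] ne] by metis
  then have "a \<in> A'" using trace x by simp
  then have ne': "A' \<noteq> {}" by blast
  obtain b where b: "b \<in> A'" "infdist x A' = dist x b"
    using infdist_attains_inf[OF compact_imp_closed[OF A'(1)] ne'] by metis
  have "dist x b \<le> dist x a" using infdist_le[OF \<open>a \<in> A'\<close>, of x] b by simp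
  moreover then have "b \<in> A" using trace[of b] b x a by simp
  then have "dist x a \<le> dist x b" using infdist_le[of b A x] a by simp
  ultimately have eq: "infdist x A' = infdist x A" using a b by simp
  then have "x \<in> unique_nearest A'" using A' reach_ge_iff[OF A'(1) assms(2)] x ne' by simp
  then show "x \<in> unique_nearest A"
    unfolding unique_nearest_def mem_Collect_eq eq using trace x by metis
qed

lemma len_nonneg: "C11_on UNIV \<gamma> \<Longrightarrow> 0 \<le> len \<gamma>"
  unfolding len_def by (intro integral_nonneg velocity_norm_integrable) auto

text \<open>Dividing by a number at least 1 does not increase a nonnegative length. Infinite
  thickness is converted to the real number 0, so the quotient is 0 by convention and the bound
  still holds.\<close>

lemma rop_le_len:
  assumes "C11_on UNIV \<gamma>" "1 \<le> thickness \<gamma>"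
  shows "rop \<gamma> \<le> len \<gamma>"
proof (cases "thickness \<gamma>")
  case (real r)
  then have "1 \<le> r" using assms(2) by simp
  then show ?thesis
    using len_nonneg[OF assms(1)] real mult_left_mono[of 1 r "len \<gamma>"] by (simp add: rop_def divide_le_eq)
qed (use assms len_nonneg in \<open>auto simp: rop_def\<close>)


section \<open>Locality of the projection\<close>

lemma eventually_proj_cong:
  "\<forall>\<^sub>F x in F. f x = g x \<Longrightarrow> \<forall>\<^sub>F x in F. proj u (f x) = proj u (g x)"
  by (auto elim: eventually_mono)

lemma cusps_cong:
  "\<forall>\<^sub>F x in nhds s. f x = g x \<Longrightarrow> s \<in> cusps u f \<longleftrightarrow> s \<in> cusps u g"
  unfolding cusps_def using velocity_cong[OF eventually_proj_cong] by simp

lemma multipoints_cong: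
  "(\<And>s. s \<in> A \<Longrightarrow> f s = g s) \<Longrightarrow> A \<in> multipoints u n f \<longleftrightarrow> A \<in> multipoints u n g"
  unfolding multipoints_def by simp

lemma tangencies_cong:
  assumes "\<And>s. s \<in> A \<Longrightarrow> \<forall>\<^sub>F x in nhds s. f x = g x"
  shows "A \<in> tangencies u f \<longleftrightarrow> A \<in> tangencies u g"
proof -
  have "A \<in> multipoints u 2 f \<longleftrightarrow> A \<in> multipoints u 2 g"
    by (rule multipoints_cong) (rule eventually_nhds_x_imp_x[OF assms])
  moreover have "velocity (\<lambda>s. proj u (f s)) s = velocity (\<lambda>s. proj u (g s)) s" if "s \<in> A" for s
    using velocity_cong[OF eventually_proj_cong[OF assms[OF that]]] .
  ultimately show ?thesis unfolding tangencies_def by simp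
qed

text \<open>The global conditions are equalities of sets of singularities and are assumed as such;
  the remaining conditions involve only the germ of the curve at the points of \<open>A\<close>.
  Double points are merely required to be finite in number, since the two curves may have different
  crossings elsewhere.\<close>

lemma on_wall_transfer:
  assumes "on_wall u \<tau> A g" "finite (multipoints u 2 f)"
    and "cusps u f = cusps u g" "tangencies u f = tangencies u g" "multipoints u 3 f = multipoints u 3 g"
    and ev: "\<And>s. s \<in> A \<Longrightarrow> \<forall>\<^sub>F x in nhds s. f x = g x"
  shows "on_wall u \<tau> A f"
proof -
  let ?f = "\<lambda>s. proj u (f s)" and ?g = "\<lambda>s. proj u (g s)"
  have e0: "\<forall>\<^sub>F x in nhds s. ?f x = ?g x" if "s \<in> A" for s
    using eventually_proj_cong[OF ev[OF that]] .
  note e1 = eventually_velocity_cong[OF e0]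
  note e2 = eventually_velocity_cong[OF e1]
  note e3 = eventually_velocity_cong[OF e2]
  note val = eventually_nhds_x_imp_x[OF e1] eventually_nhds_x_imp_x[OF e2] eventually_nhds_x_imp_x[OF e3]
  have Ck: "Ck_near 3 s ?f" if "s \<in> A" "Ck_near 3 s ?g" for s
    by (rule Ck_near_cong[OF _ that(2)]) (use e0[OF that(1)] in \<open>auto elim: eventually_mono\<close>)
  show ?thesis
    using assms(1) unfolding on_wall_def Let_def assms(3-5)
    by (cases \<tau>) (use assms(2) Ck val in auto)
qed

text \<open>Transversality contains time derivatives and a mixed derivative, so the movies must
  agree near the singular point in time and parameter jointly. The assumptions range over all
  \<open>A\<close> because the singular set is hidden by an existential in
  \<open>crosses_wall\<close>.\<close>

lemma crosses_wall_transfer: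
  assumes "crosses_wall u \<tau> g t"
    and wall: "\<And>A. on_wall u \<tau> A (g t) \<Longrightarrow> on_wall u \<tau> A (f t)"
    and ev: "\<And>A s. on_wall u \<tau> A (g t) \<Longrightarrow> s \<in> A \<Longrightarrow>
      \<exists>S T. open S \<and> t \<in> S \<and> open T \<and> s \<in> T \<and> (\<forall>t'\<in>S. \<forall>s'\<in>T. f t' s' = g t' s')"
  shows "crosses_wall u \<tau> f t"
proof -
  let ?f = "\<lambda>t s. proj u (f t s)" and ?g = "\<lambda>t s. proj u (g t s)"
  from assms(1) obtain A where A: "on_wall u \<tau> A (g t)"
    "\<forall>s\<in>A. Ck_near 3 (t, s) (\<lambda>(t, s). ?g t s)"
    "case \<tau> of
       R1 \<Rightarrow> \<forall>s\<in>A. area u (velocity (velocity (?g t)) s) (velocity (\<lambda>t. velocity (?g t) s) t) \<noteq> 0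
     | R2 \<Rightarrow> \<forall>s\<in>A. \<forall>s'\<in>A. s \<noteq> s' \<longrightarrow>
          area u (velocity (?g t) s) (velocity (\<lambda>t. ?g t s) t - velocity (\<lambda>t. ?g t s') t) \<noteq> 0
     | R3 \<Rightarrow> \<nexists>w. \<forall>s\<in>A. area u (velocity (?g t) s) (velocity (\<lambda>t. ?g t s) t - w) = 0"
    unfolding crosses_wall_def Let_def by blast
  have eq: "Ck_near 3 (t, s) (\<lambda>(t, s). ?f t s)"
    "velocity (?f t) s = velocity (?g t) s"
    "velocity (velocity (?f t)) s = velocity (velocity (?g t)) s"
    "velocity (\<lambda>t. velocity (?f t) s) t = velocity (\<lambda>t. velocity (?g t) s) t"
    "velocity (\<lambda>t. ?f t s) t = velocity (\<lambda>t. ?g t s) t" if s: "s \<in> A" for s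
  proof -
    from ev[OF A(1) s] obtain S T where ST: "open S" "t \<in> S" "open T" "s \<in> T"
      "\<And>t' s'. t' \<in> S \<Longrightarrow> s' \<in> T \<Longrightarrow> f t' s' = g t' s'" by blast
    have slice: "\<forall>\<^sub>F s' in nhds s. ?f t' s' = ?g t' s'" if "t' \<in> S" for t'
      unfolding eventually_nhds using ST(3-5) that by (intro exI[of _ T]) auto
    show v: "velocity (?f t) s = velocity (?g t) s"
      by (rule velocity_cong[OF slice[OF ST(2)]])
    show "velocity (velocity (?f t)) s = velocity (velocity (?g t)) s"
      by (rule velocity_cong[OF eventually_velocity_cong[OF slice[OF ST(2)]]])
    have "\<forall>\<^sub>F t' in nhds t. velocity (?f t') s = velocity (?g t') s"
      unfolding eventually_nhds using ST(1,2) velocity_cong[OF slice] by (intro exI[of _ S]) auto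
    then show "velocity (\<lambda>t. velocity (?f t) s) t = velocity (\<lambda>t. velocity (?g t) s) t"
      by (rule velocity_cong)
    have "\<forall>\<^sub>F t' in nhds t. ?f t' s = ?g t' s"
      unfolding eventually_nhds using ST by (intro exI[of _ S]) auto
    then show "velocity (\<lambda>t. ?f t s) t = velocity (\<lambda>t. ?g t s) t"
      by (rule velocity_cong)
    have "\<forall>\<^sub>F p in nhds (t, s). (case p of (t, s) \<Rightarrow> ?g t s) = (case p of (t, s) \<Rightarrow> ?f t s)"
      unfolding eventually_nhds using ST by (intro exI[of _ "S \<times> T"]) (auto intro: open_Times)
    then show "Ck_near 3 (t, s) (\<lambda>(t, s). ?f t s)"
      by (rule Ck_near_cong) (use A(2) s in blast)
  qed
  show ?thesis
    unfolding crosses_wall_def Let_def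
    by (rule exI[of _ A], cases \<tau>) (use A(3) eq wall[OF A(1)] in auto)
qed

section \<open>Single crossings and the Reidemeister graph\<close>

lemma regular_single_crossing:
  assumes "single_crossing u \<tau> \<Gamma>" "t \<in> {0, 1}"
  shows "regular_projection u (\<Gamma> t)"
  using assms unfolding single_crossing_def by fastforce

lemma single_crossing_projection_generic:
  assumes "single_crossing u \<tau> \<Gamma>"
  shows "projection_generic u \<Gamma>"
proof -
  from assms obtain t where "t \<in> {0<..<1}" "crosses_wall u \<tau> \<Gamma> t"
    "\<forall>r\<in>{0..1} - {t}. regular_projection u (\<Gamma> r)"
    unfolding single_crossing_def by blast
  then show ?thesis unfolding projection_generic_def by (intro exI[of _ "{t}"]) auto
qed

text \<open>The identity is an admissible similarity, so a curve may serve as the representative of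
  its own class that membership in \<open>fiber\<close> asks for.\<close>

lemma sim_class_refl: "C \<in> sim_class u C"
proof -
  have "(\<lambda>x. x) \<in> similarities u"
    unfolding similarities_def mem_Collect_eq
    by (rule exI[of _ 1], rule exI[of _ "\<lambda>x. x"], rule exI[of _ 0])
      (simp add: matrix_id_mat_1[unfolded id_def] orthogonal_transformation_id[unfolded id_def])
  then show ?thesis unfolding sim_class_def by (force intro: image_eqI[of _ _ "\<lambda>x. x"])
qed

lemma wf_digraph_G_S: "wf_digraph (G_S u K)"
proof
  fix e assume "e \<in> arcs (G_S u K)"
  then obtain \<tau> \<Gamma> where e: "e = arc_of u \<Gamma>" "admissible_movie K \<Gamma>" "single_crossing u \<tau> \<Gamma>"
    unfolding G_S_def reidemeister_arcs_def by auto
  have "\<Gamma> t \<in> {\<gamma> \<in> embeddings K. regular_projection u \<gamma>}" if "t \<in> {0, 1}" for t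
    using e(2) regular_single_crossing[OF e(3) that] that unfolding admissible_movie_def by auto
  then show "tail (G_S u K) e \<in> verts (G_S u K)" "head (G_S u K) e \<in> verts (G_S u K)"
    unfolding e(1) G_S_def arc_of_def by auto
qed


section \<open>Composite curves\<close>

locale separated_moves =
  fixes u :: "real^3" and K :: "(real^3) set set" and \<gamma>\<^sub>0 :: curve and k :: nat
    and \<Gamma> :: "nat \<Rightarrow> movie" and B :: "nat \<Rightarrow> (real^3) set" and \<tau> :: "nat \<Rightarrow> wall"
  assumes knot: "knot_type K"
    and emb0: "C11_embedding \<gamma>\<^sub>0" and range0: "range \<gamma>\<^sub>0 \<in> K" and thick0: "1 \<le> thickness \<gamma>\<^sub>0"
    and reg0: "regular_projection u \<gamma>\<^sub>0"
    and sys: "separated_system u K \<gamma>\<^sub>0 k \<Gamma> B \<tau>"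
begin

lemma system:
  assumes "i \<in> {1..k}"
  shows "compact (B i)" "admissible_movie K (\<Gamma> i)" "t \<in> {0..1} \<Longrightarrow> 1 \<le> thickness (\<Gamma> i t)"
    "\<Gamma> i 0 = \<gamma>\<^sub>0" "single_crossing u (\<tau> i) (\<Gamma> i)"
    "t \<in> {0..1} \<Longrightarrow> \<gamma>\<^sub>0 s \<notin> B i \<or> \<Gamma> i t s \<notin> B i \<Longrightarrow> \<Gamma> i t s = \<gamma>\<^sub>0 s"
proof -
  from sys assms show "admissible_movie K (\<Gamma> i)" and 0: "\<Gamma> i 0 = \<gamma>\<^sub>0" and "single_crossing u (\<tau> i) (\<Gamma> i)"
    unfolding separated_system_def by blast+
  from sys assms show "compact (B i)" unfolding separated_system_def by (metis compact_cball)
  from sys assms show "t \<in> {0..1} \<Longrightarrow> 1 \<le> thickness (\<Gamma> i t)"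
    unfolding separated_system_def by blast
  from sys assms have "stationary_outside (B i) (\<Gamma> i)" unfolding separated_system_def by blast
  with 0 show "t \<in> {0..1} \<Longrightarrow> \<gamma>\<^sub>0 s \<notin> B i \<or> \<Gamma> i t s \<notin> B i \<Longrightarrow> \<Gamma> i t s = \<gamma>\<^sub>0 s"
    unfolding stationary_outside_def by metis
qed

lemma
  assumes "i \<in> {1..k}" "j \<in> {1..k}" "i \<noteq> j"
  shows far: "x \<in> B i \<Longrightarrow> y \<in> B j \<Longrightarrow> 2 \<le> dist x y"
    and proj_disjoint: "proj u ` B i \<inter> proj u ` B j = {}"
  using sys assms setdist_le_dist[of x "B i" y "B j"] unfolding separated_system_def by force+

text \<open>Each move \<open>j\<close> is stopped at its own time \<open>\<theta> j\<close>; the displacements have disjoint supports.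
  The strand of an index that is not a move is \<open>\<gamma>\<^sub>0\<close>, and \<open>free l\<close> is the open set of parameters
  that no move other than \<open>l\<close> can displace, so that the composite curve is locally a strand.\<close>

definition composite :: "(nat \<Rightarrow> real) \<Rightarrow> curve" where
  "composite \<theta> = (\<lambda>s. \<gamma>\<^sub>0 s + (\<Sum>j\<in>{1..k}. \<Gamma> j (\<theta> j) s - \<gamma>\<^sub>0 s))"

definition strand :: "(nat \<Rightarrow> real) \<Rightarrow> nat \<Rightarrow> curve" where
  "strand \<theta> l = (if l \<in> {1..k} then \<Gamma> l (\<theta> l) else \<gamma>\<^sub>0)"

definition free :: "nat \<Rightarrow> real set" where
  "free l = {s. \<forall>m\<in>{1..k} - {l}. \<gamma>\<^sub>0 s \<notin> B m}"

text \<open>Disjointness always enters in this form: a property that at most one move can have fails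
  for every move other than some \<open>l\<close>. If no move has it, \<open>l = 0\<close> is
  returned; 0 is not a move index, and its strand is \<open>\<gamma>\<^sub>0\<close>.\<close>

lemma one_index:
  assumes "\<And>i j. i \<in> {1..k} \<Longrightarrow> j \<in> {1..k} \<Longrightarrow> P i \<Longrightarrow> P j \<Longrightarrow> i = j"
  obtains l where "l \<in> {0..k}" "\<And>m. m \<in> {1..k} - {l} \<Longrightarrow> \<not> P m"
proof (cases "\<exists>i\<in>{1..k}. P i")
  case True
  then obtain i where "i \<in> {1..k}" "P i" by blast
  with assms show thesis by (intro that[of i]) auto
next
  case False
  then show thesis by (intro that[of 0]) auto
qed

lemma balls_disjoint: "i \<in> {1..k} \<Longrightarrow> j \<in> {1..k} \<Longrightarrow> x \<in> B i \<Longrightarrow> x \<in> B j \<Longrightarrow> i = j"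
  using far[of i j x x] by auto

lemma free_cover: obtains l where "l \<in> {0..k}" "s \<in> free l"
  by (rule one_index[of "\<lambda>m. \<gamma>\<^sub>0 s \<in> B m"]) (auto intro: balls_disjoint simp: free_def)

lemma free_ball: "i \<in> {1..k} \<Longrightarrow> \<gamma>\<^sub>0 s \<in> B i \<Longrightarrow> s \<in> free i"
  unfolding free_def using balls_disjoint by auto

lemma open_outside: "i \<in> {1..k} \<Longrightarrow> open {s. \<gamma>\<^sub>0 s \<notin> B i}"
proof -
  assume "i \<in> {1..k}"
  then have "open (\<gamma>\<^sub>0 -` (- B i))"
    by (intro open_vimage C11_continuous C11_embeddingD[OF emb0]) (use system(1) compact_imp_closed in auto)
  then show ?thesis by (simp add: vimage_def)
qed

lemma open_free: "open (free l)"
proof -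
  have "free l = (\<Inter>m\<in>{1..k} - {l}. {s. \<gamma>\<^sub>0 s \<notin> B m})" unfolding free_def by auto
  then show ?thesis by (auto intro!: open_INT open_outside)
qed

text \<open>Since \<open>\<Gamma> i 0 = \<gamma>\<^sub>0\<close>, setting time \<open>i\<close> to 0
  removes the displacement of move \<open>i\<close>. The bracket is thus the displacement by all
  other moves and does not depend on \<open>t\<close>.\<close>

lemma composite_update:
  assumes "i \<in> {1..k}"
  shows "composite (\<theta>(i := t)) s = \<Gamma> i t s + (composite (\<theta>(i := 0)) s - \<gamma>\<^sub>0 s)"
proof -
  have "(\<Sum>j\<in>{1..k}. \<Gamma> j ((\<theta>(i := t)) j) s - \<gamma>\<^sub>0 s)
      = (\<Gamma> i t s - \<gamma>\<^sub>0 s) + (\<Sum>j\<in>{1..k} - {i}. \<Gamma> j (\<theta> j) s - \<gamma>\<^sub>0 s)" for t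
    unfolding sum.remove[OF finite_atLeastAtMost assms] by (auto intro!: sum.cong)
  then show ?thesis unfolding composite_def by (simp add: system(4)[OF assms])
qed

context
  fixes \<theta> :: "nat \<Rightarrow> real"
  assumes range_times: "range \<theta> \<subseteq> {0..1}"
begin

lemma times: "\<theta> j \<in> {0..1}"
  using range_times by blast

lemma composite_eq_strand:
  assumes "s \<in> free l"
  shows "composite \<theta> s = strand \<theta> l s"
proof -
  have "(\<Sum>j\<in>{1..k}. \<Gamma> j (\<theta> j) s - \<gamma>\<^sub>0 s) = (\<Sum>j\<in>{1..k}. if j = l then \<Gamma> l (\<theta> l) s - \<gamma>\<^sub>0 s else 0)"
    using system(6)[OF _ times] assms unfolding free_def by (intro sum.cong) auto
  then show ?thesis unfolding composite_def strand_def by simp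
qed

lemma eventually_composite_eq_strand:
  "s \<in> free l \<Longrightarrow> \<forall>\<^sub>F x in nhds s. composite \<theta> x = strand \<theta> l x"
  unfolding eventually_nhds using open_free composite_eq_strand by blast

lemma eventually_strand_eq:
  "l \<in> {1..k} \<Longrightarrow> \<gamma>\<^sub>0 s \<notin> B l \<Longrightarrow> \<forall>\<^sub>F x in nhds s. strand \<theta> l x = \<gamma>\<^sub>0 x"
  unfolding eventually_nhds strand_def using open_outside system(6)[OF _ times]
  by (intro exI[of _ "{s. \<gamma>\<^sub>0 s \<notin> B l}"]) auto

text \<open>If move \<open>m\<close> carried the point out of \<open>B m\<close>, stationarity would
  make its position equal to the initial one, which is inside. Any other move fixes the point
  because the balls are disjoint.\<close>

lemma strand_stays:
  assumes "m \<in> {1..k}" "\<gamma>\<^sub>0 s \<in> B m"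
  shows "strand \<theta> l s \<in> B m"
proof (cases "l \<in> {1..k} \<and> l \<noteq> m")
  case True
  then have "\<gamma>\<^sub>0 s \<notin> B l" using balls_disjoint assms by blast
  then show ?thesis using True system(6)[OF _ times[of l], where i = l and s = s] assms unfolding strand_def by auto
next
  case False
  then consider "l = m" | "l \<notin> {1..k}" by blast
  then show ?thesis
  proof cases
    case 1
    then show ?thesis
      using system(6)[OF assms(1) times[of m], where s = s] assms
      by (cases "\<Gamma> m (\<theta> m) s \<in> B m") (auto simp: strand_def)
  qed (use assms(2) in \<open>auto simp: strand_def\<close>)
qed

lemma composite_stays: "m \<in> {1..k} \<Longrightarrow> \<gamma>\<^sub>0 s \<in> B m \<Longrightarrow> composite \<theta> s \<in> B m"
  using composite_eq_strand[OF free_ball] strand_stays by simp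

text \<open>Freeness is defined by the initial position \<open>\<gamma>\<^sub>0 s\<close>. Since
  points starting in a ball stay there, it can also be read off from the current position, which is
  what is known about points of a composite curve or of its projection.\<close>

lemma
  shows free_strandI: "(\<And>m. m \<in> {1..k} - {l} \<Longrightarrow> strand \<theta> l s \<notin> B m) \<Longrightarrow> s \<in> free l"
    and free_compositeI: "(\<And>m. m \<in> {1..k} - {l} \<Longrightarrow> composite \<theta> s \<notin> B m) \<Longrightarrow> s \<in> free l"
  unfolding free_def using strand_stays composite_stays by blast+

lemma strand_embedding: "strand \<theta> l \<in> embeddings K" "1 \<le> thickness (strand \<theta> l)"
proof -
  have "0 < thickness \<gamma>\<^sub>0" by (rule order_less_le_trans[OF _ thick0]) simp
  then have "\<gamma>\<^sub>0 \<in> embeddings K"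
    using emb0 range0 unfolding embeddings_def by simp
  then show "strand \<theta> l \<in> embeddings K"
    using system(2) times unfolding strand_def admissible_movie_def by auto
  show "1 \<le> thickness (strand \<theta> l)"
    using system(3) times thick0 unfolding strand_def by auto
qed

lemma strand_C11: "C11_embedding (strand \<theta> l)"
  using strand_embedding(1) unfolding embeddings_def by simp

section \<open>Embeddedness, thickness and length of composite curves\<close>

lemma C11_composite: "C11_on UNIV (composite \<theta>)"
proof -
  have "C11_on UNIV (\<Gamma> j (\<theta> j))" if "j \<in> {1..k}" for j
    using C11_embeddingD(2)[OF strand_C11[of j]] that unfolding strand_def by simp
  then show ?thesis unfolding composite_def
    by (intro C11_on_add C11_on_sum C11_on_diff C11_embeddingD(2)[OF emb0]) auto
qed

lemma composite_embedding: "C11_embedding (composite \<theta>)"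
  unfolding C11_embedding_def
proof (intro conjI allI)
  show "composite \<theta> (s + 1) = composite \<theta> s" for s
  proof -
    have "\<Gamma> j (\<theta> j) (s + 1) = \<Gamma> j (\<theta> j) s" if "j \<in> {1..k}" for j
      using C11_embeddingD(1)[OF strand_C11[of j]] that unfolding strand_def by simp
    then show ?thesis unfolding composite_def using C11_embeddingD(1)[OF emb0] by simp
  qed
  show "velocity (composite \<theta>) s \<noteq> 0" for s
  proof -
    obtain l where "s \<in> free l" using free_cover by blast
    with velocity_cong[OF eventually_composite_eq_strand] C11_embeddingD(3)[OF strand_C11]
    show ?thesis by metis
  qed
  show "inj_on (composite \<theta>) {0..<1}"
  proof (rule inj_onI)
    fix s s' assume s: "s \<in> {0..<1}" "s' \<in> {0..<1}" and eq: "composite \<theta> s = composite \<theta> s'"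
    \<comment> \<open>The common image point lies in at most one ball, so both parameters are free
      for the same \<open>l\<close>, and injectivity of that one strand applies.\<close>
    obtain l where l: "\<And>m. m \<in> {1..k} - {l} \<Longrightarrow> composite \<theta> s \<notin> B m"
      using one_index[of "\<lambda>m. composite \<theta> s \<in> B m"] balls_disjoint by metis
    then have "s \<in> free l" "s' \<in> free l" using eq by (auto intro: free_compositeI)
    then have "strand \<theta> l s = strand \<theta> l s'" using eq composite_eq_strand by metis
    then show "s = s'" using inj_onD[OF C11_embeddingD(4)[OF strand_C11[of l]]] s by blast
  qed
qed (rule C11_composite)

text \<open>A ball of radius 1 meets at most one of the \<open>B m\<close>, hence sees a single strand.\<close>

lemma composite_thickness: "1 \<le> thickness (composite \<theta>)"
  unfolding thickness_def one_ereal_def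
proof (rule reach_ge_local)
  show "compact (range (composite \<theta>))" by (rule compact_range_C11_embedding[OF composite_embedding])
  fix x
  obtain l where l: "\<And>m. m \<in> {1..k} - {l} \<Longrightarrow> \<not> ball x 1 \<inter> B m \<noteq> {}"
  proof (rule one_index[of "\<lambda>m. ball x 1 \<inter> B m \<noteq> {}"])
    fix i j assume ij: "i \<in> {1..k}" "j \<in> {1..k}" "ball x 1 \<inter> B i \<noteq> {}" "ball x 1 \<inter> B j \<noteq> {}"
    then obtain y z where "y \<in> B i" "z \<in> B j" "dist x y < 1" "dist x z < 1" by auto
    \<comment> \<open>Both points are strictly closer than 1 to \<open>x\<close> because the ball is
      open; hence separation by exactly 2 is enough.\<close>
    moreover from this have "dist y z < 2" using dist_triangle3[of y z x] by simp
    ultimately show "i = j" using far[OF ij(1,2)] by force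
  qed blast
  have "s \<in> free l" if "composite \<theta> s \<in> ball x 1" for s
    by (rule free_compositeI) (use l that in blast)
  moreover have "s \<in> free l" if "strand \<theta> l s \<in> ball x 1" for s
    by (rule free_strandI) (use l that in blast)
  ultimately have "composite \<theta> s \<in> ball x 1 \<or> strand \<theta> l s \<in> ball x 1 \<Longrightarrow> composite \<theta> s = strand \<theta> l s" for s
    using composite_eq_strand by blast
  then have "range (composite \<theta>) \<inter> ball x 1 = range (strand \<theta> l) \<inter> ball x 1"
    by (auto simp: image_iff) metis+
  then show "\<exists>A'. compact A' \<and> ereal 1 \<le> reach A' \<and> range (composite \<theta>) \<inter> ball x 1 = A' \<inter> ball x 1"
    using compact_range_C11_embedding[OF strand_C11] strand_embedding(2)[of l]
    unfolding thickness_def one_ereal_def by blast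
qed simp

text \<open>The lengths add because the speeds already do: at a parameter free for \<open>l\<close>,
  every other \<open>\<Gamma> j\<close> coincides with \<open>\<gamma>\<^sub>0\<close> nearby, so at
  most one summand is nonzero.\<close>

lemma len_composite: "len (composite \<theta>) = len \<gamma>\<^sub>0 + (\<Sum>j\<in>{1..k}. len (\<Gamma> j (\<theta> j)) - len \<gamma>\<^sub>0)"
proof -
  let ?n = "\<lambda>\<gamma> s. norm (velocity \<gamma> s)"
  have pointwise: "?n (composite \<theta>) s = ?n \<gamma>\<^sub>0 s + (\<Sum>j\<in>{1..k}. ?n (\<Gamma> j (\<theta> j)) s - ?n \<gamma>\<^sub>0 s)" for s
  proof -
    obtain l where l: "s \<in> free l" using free_cover by blast
    have "?n (\<Gamma> j (\<theta> j)) s = ?n \<gamma>\<^sub>0 s" if "j \<in> {1..k}" "j \<noteq> l" for j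
      using velocity_cong[OF eventually_strand_eq[of j s]] that l unfolding free_def strand_def by simp
    then have "(\<Sum>j\<in>{1..k}. ?n (\<Gamma> j (\<theta> j)) s - ?n \<gamma>\<^sub>0 s)
        = (\<Sum>j\<in>{1..k}. if j = l then ?n (\<Gamma> l (\<theta> l)) s - ?n \<gamma>\<^sub>0 s else 0)"
      by (intro sum.cong) auto
    then show ?thesis
      using velocity_cong[OF eventually_composite_eq_strand[OF l]] unfolding strand_def by simp
  qed
  have int: "?n \<gamma>\<^sub>0 integrable_on {0..1}" "\<And>j. j \<in> {1..k} \<Longrightarrow> ?n (\<Gamma> j (\<theta> j)) integrable_on {0..1}"
    using velocity_norm_integrable[OF C11_embeddingD(2)[OF emb0]]
      velocity_norm_integrable[OF C11_embeddingD(2)[OF strand_C11]] unfolding strand_def by metis+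
  have "len (composite \<theta>)
      = integral {0..1} (?n \<gamma>\<^sub>0) + integral {0..1} (\<lambda>s. \<Sum>j\<in>{1..k}. ?n (\<Gamma> j (\<theta> j)) s - ?n \<gamma>\<^sub>0 s)"
    unfolding len_def pointwise by (intro integral_add integrable_sum integrable_diff int) auto
  also have "integral {0..1} (\<lambda>s. \<Sum>j\<in>{1..k}. ?n (\<Gamma> j (\<theta> j)) s - ?n \<gamma>\<^sub>0 s)
      = (\<Sum>j\<in>{1..k}. integral {0..1} (\<lambda>s. ?n (\<Gamma> j (\<theta> j)) s - ?n \<gamma>\<^sub>0 s))"
    by (intro integral_sum integrable_diff int) auto
  also have "\<dots> = (\<Sum>j\<in>{1..k}. len (\<Gamma> j (\<theta> j)) - len \<gamma>\<^sub>0)"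
    unfolding len_def by (intro sum.cong integral_diff int) auto
  finally show ?thesis unfolding len_def .
qed

lemma len_composite_le: "len (composite \<theta>) \<le> cube_level \<gamma>\<^sub>0 k \<Gamma>"
proof -
  have "len (\<Gamma> j (\<theta> j)) \<le> (SUP t\<in>{0..1}. len (\<Gamma> j t))" if "j \<in> {1..k}" for j
    using system(2)[OF that] times unfolding admissible_movie_def embeddings_def
    by (intro cSUP_upper len_bdd_above) (auto dest: C11_embeddingD(2))
  then show ?thesis
    unfolding len_composite cube_level_def by (intro add_left_mono sum_mono) fastforce
qed

section \<open>Projections of composite curves\<close>

lemma multipoint_free:
  assumes "A \<in> multipoints u n (composite \<theta>)"
  obtains l where "l \<in> {0..k}" "A \<subseteq> free l"
proof -
  from assms obtain x where x: "\<And>s. s \<in> A \<Longrightarrow> proj u (composite \<theta> s) = x"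
    unfolding multipoints_def by blast
  \<comment> \<open>All parameters of a multiple point share the projected point \<open>x\<close>,
    and \<open>x\<close> lies in the shadow of at most one ball.\<close>
  obtain l where l: "l \<in> {0..k}" "\<And>m. m \<in> {1..k} - {l} \<Longrightarrow> x \<notin> proj u ` B m"
    using one_index[of "\<lambda>m. x \<in> proj u ` B m"] proj_disjoint by (metis IntI emptyE)
  have "s \<in> free l" if "s \<in> A" for s
    by (rule free_compositeI) (use l(2) x[OF that] in blast)
  with l(1) that show thesis by blast
qed

lemma multipoint_composite_iff: "A \<subseteq> free l \<Longrightarrow> A \<in> multipoints u n (composite \<theta>) \<longleftrightarrow> A \<in> multipoints u n (strand \<theta> l)"
  by (intro multipoints_cong composite_eq_strand) auto

lemma tangency_composite_iff: "A \<subseteq> free l \<Longrightarrow> A \<in> tangencies u (composite \<theta>) \<longleftrightarrow> A \<in> tangencies u (strand \<theta> l)"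
  by (intro tangencies_cong eventually_composite_eq_strand) auto

lemma cusp_composite_iff: "s \<in> free l \<Longrightarrow> s \<in> cusps u (composite \<theta>) \<longleftrightarrow> s \<in> cusps u (strand \<theta> l)"
  by (intro cusps_cong eventually_composite_eq_strand)

lemma finite_double_points:
  assumes "\<And>l. finite (multipoints u 2 (strand \<theta> l))"
  shows "finite (multipoints u 2 (composite \<theta>))"
proof (rule finite_subset)
  show "multipoints u 2 (composite \<theta>) \<subseteq> (\<Union>l\<in>{0..k}. multipoints u 2 (strand \<theta> l))"
  proof
    fix A assume A: "A \<in> multipoints u 2 (composite \<theta>)"
    then obtain l where "l \<in> {0..k}" "A \<subseteq> free l" by (rule multipoint_free)
    with A show "A \<in> (\<Union>l\<in>{0..k}. multipoints u 2 (strand \<theta> l))"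
      using multipoint_composite_iff by blast
  qed
qed (use assms in auto)

lemma regular_composite:
  assumes "\<And>l. regular_projection u (strand \<theta> l)"
  shows "regular_projection u (composite \<theta>)"
  unfolding regular_projection_def
proof (intro conjI)
  have reg: "finite (multipoints u 2 (strand \<theta> l))" "cusps u (strand \<theta> l) = {}"
    "tangencies u (strand \<theta> l) = {}" "multipoints u 3 (strand \<theta> l) = {}" for l
    using assms[of l] unfolding regular_projection_def by auto
  show "finite (multipoints u 2 (composite \<theta>))" by (rule finite_double_points[OF reg(1)])
  show "cusps u (composite \<theta>) = {}"
  proof (rule equals0I)
    fix s assume s: "s \<in> cusps u (composite \<theta>)"
    obtain l where "s \<in> free l" by (rule free_cover)
    with s show False using cusp_composite_iff reg(2) by blast
  qed
  show "multipoints u 3 (composite \<theta>) = {}"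
  proof (rule equals0I)
    fix A assume A: "A \<in> multipoints u 3 (composite \<theta>)"
    then obtain l where "A \<subseteq> free l" by (rule multipoint_free)
    with A show False using multipoint_composite_iff reg(4) by blast
  qed
  show "tangencies u (composite \<theta>) = {}"
  proof (rule equals0I)
    fix A assume A: "A \<in> tangencies u (composite \<theta>)"
    then have "A \<in> multipoints u 2 (composite \<theta>)" unfolding tangencies_def by simp
    then obtain l where "A \<subseteq> free l" by (rule multipoint_free)
    with A show False using tangency_composite_iff reg(3) by blast
  qed
qed

end

section \<open>Composite movies and the knot type\<close>

lemma strand_eq: "(l \<in> {1..k} \<Longrightarrow> \<theta> l = \<theta>' l) \<Longrightarrow> strand \<theta> l = strand \<theta>' l"
  unfolding strand_def by auto

text \<open>The lower bound must be uniform over all stopping times. Locally a composite curve is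
  one of the finitely many strands, each with a bound uniform in time, and the minimum of these
  works.\<close>

lemma composite_speed:
  obtains c where "0 < c" "\<And>\<theta> s. range \<theta> \<subseteq> {0..1} \<Longrightarrow> c \<le> norm (velocity (composite \<theta>) s)"
proof -
  \<comment> \<open>Strand \<open>l\<close> depends on the stopping times only through the time of
    move \<open>l\<close>, so constant time functions cover every case.\<close>
  have "\<exists>c>0. \<forall>t\<in>{0..1}. \<forall>s. c \<le> norm (velocity (strand (\<lambda>_. t) l) s)" for l
  proof (cases "l \<in> {1..k}")
    case True
    then show ?thesis using system(2)[OF True] unfolding strand_def admissible_movie_def by auto
  next
    case False
    obtain c where "0 < c" "\<And>s. c \<le> norm (velocity \<gamma>\<^sub>0 s)" using speed_lower_bound[OF emb0] by metis
    with False show ?thesis unfolding strand_def by auto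
  qed
  then obtain c where c: "\<And>l. 0 < c l"
    "\<And>l t s. t \<in> {0..1} \<Longrightarrow> c l \<le> norm (velocity (strand (\<lambda>_. t) l) s)" by metis
  show thesis
  proof (rule that[of "Min (c ` {0..k})"])
    show "0 < Min (c ` {0..k})" using c(1) by simp
    fix \<theta> :: "nat \<Rightarrow> real" and s assume \<theta>: "range \<theta> \<subseteq> {0..1}"
    obtain l where l: "l \<in> {0..k}" "s \<in> free l" by (rule free_cover)
    have "Min (c ` {0..k}) \<le> c l" using l(1) by simp
    also have "\<dots> \<le> norm (velocity (strand (\<lambda>_. \<theta> l) l) s)" by (rule c(2)) (use \<theta> in blast)
    also have "\<dots> = norm (velocity (composite \<theta>) s)"
      using velocity_cong[OF eventually_composite_eq_strand[OF \<theta> l(2)]] strand_eq[of l "\<lambda>_. \<theta> l" \<theta>] by simp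
    finally show "Min (c ` {0..k}) \<le> norm (velocity (composite \<theta>) s)" .
  qed
qed

lemma range_upd: "range f \<subseteq> A \<Longrightarrow> a \<in> A \<Longrightarrow> range (f(i := a)) \<subseteq> A"
  by auto

text \<open>The movie is \<open>\<Gamma> i\<close> plus a displacement constant in time, so the
  subdivision for \<open>\<Gamma> i\<close> serves again. Agreement with \<open>composite\<close> is
  asked for on [0,1] only, as stationarity says nothing about other times.\<close>

lemma piecewise_C11_composite:
  assumes i: "i \<in> {1..k}" and \<theta>: "range \<theta> \<subseteq> {0..1}"
    and M: "\<And>t. t \<in> {0..1} \<Longrightarrow> M t = composite (\<theta>(i := t))"
  shows "piecewise_C11 M"
proof -
  have "piecewise_C11 (\<Gamma> i)" using system(2)[OF i] unfolding admissible_movie_def by simp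
  then obtain I where I: "finite I" "\<forall>a b. 0 \<le> a \<and> a < b \<and> b \<le> 1 \<and> {a<..<b} \<inter> I = {} \<longrightarrow>
      C11_on ({a..b} \<times> UNIV) (\<lambda>(t, s). \<Gamma> i t s)"
    unfolding piecewise_C11_def by (elim exE conjE)
  let ?g = "\<lambda>s. composite (\<theta>(i := 0)) s - \<gamma>\<^sub>0 s"
  have "C11_on UNIV ?g"
    using \<theta> by (intro C11_on_diff C11_composite C11_embeddingD(2)[OF emb0] range_upd) auto
  note g = C11_on_snd[OF this]
  have "C11_on ({a..b} \<times> UNIV) (\<lambda>(t, s). M t s)"
    if ab: "0 \<le> a" "a < b" "b \<le> 1" "{a<..<b} \<inter> I = {}" for a b
  proof (rule C11_on_cong[OF _ C11_on_add[OF _ g]])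
    show "C11_on ({a..b} \<times> UNIV) (\<lambda>(t, s). \<Gamma> i t s)" using I(2) ab by simp
    fix p assume "p \<in> {a..b} \<times> (UNIV :: real set)"
    then show "(case p of (t, s) \<Rightarrow> \<Gamma> i t s) + (case p of (t, s) \<Rightarrow> ?g s) = (case p of (t, s) \<Rightarrow> M t s)"
      using M[of "fst p"] composite_update[OF i, of \<theta> "fst p" "snd p"] ab by (auto simp: split_def)
  qed
  with I(1) show ?thesis unfolding piecewise_C11_def by blast
qed

lemma range_composite:
  assumes "range \<theta> \<subseteq> {0..1}"
  shows "range (composite \<theta>) \<in> K"
proof -
  \<comment> \<open>The moves up to \<open>n\<close> have been run to their stopping times and the
    later ones have not started. Passing from \<open>n\<close> to \<open>Suc n\<close> runs one
    movie from time 0 to \<open>\<theta> (Suc n)\<close>.\<close>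
  let ?\<theta> = "\<lambda>n j. if j \<le> n then \<theta> j else 0"
  have "range (composite (?\<theta> n)) \<in> K" if "n \<le> k" for n
    using that
  proof (induction n)
    case 0
    have "composite (?\<theta> 0) = \<gamma>\<^sub>0" unfolding composite_def using system(4) by (auto intro!: sum.neutral)
    then show ?case using range0 by simp
  next
    case (Suc n)
    have i: "Suc n \<in> {1..k}" using Suc.prems by simp
    have "\<theta> j \<in> {0..1}" for j using assms by blast
    then have le: "range (?\<theta> n) \<subseteq> {0..1}" by auto
    have "range (composite ((?\<theta> n)(Suc n := \<theta> (Suc n)))) \<in> K"
    proof (rule knot_type_movie[OF knot, of "\<lambda>t. composite ((?\<theta> n)(Suc n := t))"])
      show "piecewise_C11 (\<lambda>t. composite ((?\<theta> n)(Suc n := t)))"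
        by (rule piecewise_C11_composite[OF i le]) (rule refl)
      show "C11_embedding (composite ((?\<theta> n)(Suc n := t)))" if "t \<in> {0..1}" for t
        by (rule composite_embedding) (rule range_upd[OF le that])
      have "(?\<theta> n)(Suc n := 0) = ?\<theta> n" by auto
      then show "range (composite ((?\<theta> n)(Suc n := 0))) \<in> K" using Suc by simp
    qed (use assms in blast)
    moreover have "(?\<theta> n)(Suc n := \<theta> (Suc n)) = ?\<theta> (Suc n)" by (auto simp: le_Suc_eq)
    ultimately show ?case by simp
  qed
  from this[of k] have "range (composite (?\<theta> k)) \<in> K" by simp
  moreover have "composite (?\<theta> k) = composite \<theta>" unfolding composite_def by auto
  ultimately show ?thesis by simp
qed

lemma composite_level:
  assumes "range \<theta> \<subseteq> {0..1}"
  shows "composite \<theta> \<in> embeddings K" "rop (composite \<theta>) \<le> cube_level \<gamma>\<^sub>0 k \<Gamma>"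
proof -
  have "0 < thickness (composite \<theta>)"
    by (rule order_less_le_trans[OF _ composite_thickness[OF assms]]) simp
  then show "composite \<theta> \<in> embeddings K"
    unfolding embeddings_def using composite_embedding[OF assms] range_composite[OF assms] by simp
  show "rop (composite \<theta>) \<le> cube_level \<gamma>\<^sub>0 k \<Gamma>"
    using rop_le_len[OF C11_composite[OF assms] composite_thickness[OF assms]] len_composite_le[OF assms]
    by linarith
qed

lemma composite_movie_admissible:
  assumes i: "i \<in> {1..k}" and \<theta>: "range \<theta> \<subseteq> {0..1}"
    and M: "\<And>t. t \<in> {0..1} \<Longrightarrow> M t = composite (\<theta>(i := t))"
  shows "level_admissible_movie (cube_level \<gamma>\<^sub>0 k \<Gamma>) K M"
proof -
  note times = range_upd[OF \<theta>]
  obtain c where "0 < c" "\<And>\<theta> s. range \<theta> \<subseteq> {0..1} \<Longrightarrow> c \<le> norm (velocity (composite \<theta>) s)"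
    using composite_speed by metis
  then have "\<exists>c>0. \<forall>t\<in>{0..1}. \<forall>s. c \<le> norm (velocity (M t) s)" using M times by (intro exI[of _ c]) (simp del: fun_upd_apply)
  then show ?thesis
    unfolding level_admissible_movie_def admissible_movie_def
    using piecewise_C11_composite[OF i \<theta> M] composite_level[OF times] M by (simp del: fun_upd_apply)
qed

section \<open>The wall crossed by a composite movie\<close>

lemma regular_strand:
  assumes "\<theta> l \<in> {0, 1}"
  shows "regular_projection u (strand \<theta> l)"
  using regular_single_crossing[OF system(5) assms] reg0 unfolding strand_def by simp

text \<open>One parameter starting in \<open>B i\<close> puts the common projected point into the
  shadow of \<open>B i\<close>. That shadow misses the shadows of the other balls, so none of the
  remaining parameters can belong to another move.\<close>

lemma multipoint_strand_free:
  assumes \<theta>: "range \<theta> \<subseteq> {0..1}" and i: "i \<in> {1..k}"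
    and A: "A \<in> multipoints u n (strand \<theta> i)" "s \<in> A" "\<gamma>\<^sub>0 s \<in> B i"
  shows "A \<subseteq> free i"
proof
  fix s' assume s': "s' \<in> A"
  have eq: "proj u (strand \<theta> i s) = proj u (strand \<theta> i s')"
    using A(1,2) s' unfolding multipoints_def by auto
  have "proj u (strand \<theta> i s) \<in> proj u ` B i" using strand_stays[OF \<theta> i A(3)] by blast
  then have "proj u (strand \<theta> i s') \<notin> proj u ` B m" if "m \<in> {1..k} - {i}" for m
    using proj_disjoint[of i m] i that eq by auto
  then show "s' \<in> free i" by (intro free_strandI[OF \<theta>]) blast
qed

text \<open>A singular point of the moving strand lies in \<open>B i\<close>, since elsewhere the strand is the
  regular curve \<open>\<gamma>\<^sub>0\<close>; there no other strand can interfere.\<close>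

lemma
  assumes \<theta>: "range \<theta> \<subseteq> {0..1}" and i: "i \<in> {1..k}"
  shows cusp_strand_free: "s \<in> cusps u (strand \<theta> i) \<Longrightarrow> s \<in> free i"
    and tangency_strand_free: "A \<in> tangencies u (strand \<theta> i) \<Longrightarrow> A \<subseteq> free i"
    and triple_strand_free: "A \<in> multipoints u 3 (strand \<theta> i) \<Longrightarrow> A \<subseteq> free i"
proof -
  have reg: "cusps u \<gamma>\<^sub>0 = {}" "tangencies u \<gamma>\<^sub>0 = {}" "multipoints u 3 \<gamma>\<^sub>0 = {}"
    using reg0 unfolding regular_projection_def by auto
  note ev = eventually_strand_eq[OF \<theta> i]
  show "s \<in> free i" if "s \<in> cusps u (strand \<theta> i)"
  proof (rule free_ball[OF i], rule ccontr)
    assume "\<gamma>\<^sub>0 s \<notin> B i"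
    from that cusps_cong[OF ev[OF this]] reg(1) show False by simp
  qed
  show "A \<subseteq> free i" if A: "A \<in> tangencies u (strand \<theta> i)"
  proof (cases "\<exists>s\<in>A. \<gamma>\<^sub>0 s \<in> B i")
    case True
    have "A \<in> multipoints u 2 (strand \<theta> i)" using A unfolding tangencies_def by simp
    with True show ?thesis using multipoint_strand_free[OF \<theta> i] by blast
  next
    case False
    then have "A \<in> tangencies u \<gamma>\<^sub>0" using A tangencies_cong[of A "strand \<theta> i" \<gamma>\<^sub>0] ev by blast
    then show ?thesis using reg(2) by simp
  qed
  show "A \<subseteq> free i" if A: "A \<in> multipoints u 3 (strand \<theta> i)"
  proof (cases "\<exists>s\<in>A. \<gamma>\<^sub>0 s \<in> B i")
    case True
    with A show ?thesis using multipoint_strand_free[OF \<theta> i] by blast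
  next
    case False
    then have "strand \<theta> i s = \<gamma>\<^sub>0 s" if "s \<in> A" for s using eventually_nhds_x_imp_x[OF ev] that by blast
    then have "A \<in> multipoints u 3 \<gamma>\<^sub>0" using A multipoints_cong[of A "strand \<theta> i" \<gamma>\<^sub>0] by blast
    then show ?thesis using reg(3) by simp
  qed
qed

text \<open>Both inclusions between the singularities are needed. A singularity of the composite
  curve belongs to one strand, necessarily strand \<open>i\<close>, as the others stand at time 0 or
  1 and are regular. Conversely, a singularity of strand \<open>i\<close> has only parameters in
  \<open>free i\<close>, where the composite curve coincides with it.\<close>

lemma on_wall_composite:
  assumes \<theta>: "range \<theta> \<subseteq> {0..1}" "\<And>j. j \<noteq> i \<Longrightarrow> \<theta> j \<in> {0, 1}" and i: "i \<in> {1..k}"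
    and wall: "on_wall u w A (\<Gamma> i (\<theta> i))"
  shows "on_wall u w A (composite \<theta>)" "A \<subseteq> free i"
proof -
  have s: "strand \<theta> i = \<Gamma> i (\<theta> i)" unfolding strand_def using i by simp
  have reg: "finite (multipoints u 2 (strand \<theta> l))" "cusps u (strand \<theta> l) = {}"
    "tangencies u (strand \<theta> l) = {}" "multipoints u 3 (strand \<theta> l) = {}" if "l \<noteq> i" for l
    using regular_strand[where \<theta> = \<theta> and l = l] \<theta>(2)[OF that] unfolding regular_projection_def by auto
  note singular_free = cusp_strand_free[OF \<theta>(1) i] tangency_strand_free[OF \<theta>(1) i] triple_strand_free[OF \<theta>(1) i]
  \<comment> \<open>For each wall type, \<open>A\<close> consists of parameters of cusps, of a
    tangency or of a triple point, so one of the three freeness results applies.\<close>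
  have "A = cusps u (strand \<theta> i) \<or> A \<in> tangencies u (strand \<theta> i) \<or> A \<in> multipoints u 3 (strand \<theta> i)"
    using wall unfolding on_wall_def Let_def s by (cases w) auto
  then show free: "A \<subseteq> free i" using singular_free by blast
  show "on_wall u w A (composite \<theta>)"
  proof (rule on_wall_transfer[OF wall])
    have "finite (multipoints u 2 (strand \<theta> i))" using wall unfolding on_wall_def Let_def s by simp
    then show "finite (multipoints u 2 (composite \<theta>))"
      by (intro finite_double_points[OF \<theta>(1)]) (use reg(1) in metis)
    have "s \<in> cusps u (composite \<theta>) \<longleftrightarrow> s \<in> cusps u (strand \<theta> i)" for s
    proof -
      obtain l where l: "s \<in> free l" by (rule free_cover)
      show ?thesis
        using cusp_composite_iff[OF \<theta>(1) l] cusp_composite_iff[OF \<theta>(1), of s i] singular_free(1) reg(2)[of l] by blast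
    qed
    then show "cusps u (composite \<theta>) = cusps u (\<Gamma> i (\<theta> i))" unfolding s by blast
    have "A \<in> tangencies u (strand \<theta> i)" if A: "A \<in> tangencies u (composite \<theta>)" for A
    proof -
      have "A \<in> multipoints u 2 (composite \<theta>)" using A unfolding tangencies_def by simp
      then obtain l where l: "A \<subseteq> free l" by (rule multipoint_free[OF \<theta>(1)])
      with A show ?thesis using tangency_composite_iff[OF \<theta>(1) l] reg(3)[of l] by blast
    qed
    moreover have "A \<in> tangencies u (composite \<theta>)" if "A \<in> tangencies u (strand \<theta> i)" for A
      using tangency_composite_iff[OF \<theta>(1) singular_free(2)[OF that]] that by simp
    ultimately show "tangencies u (composite \<theta>) = tangencies u (\<Gamma> i (\<theta> i))"
      unfolding s by (intro set_eqI iffI)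
    have "A \<in> multipoints u 3 (strand \<theta> i)" if A: "A \<in> multipoints u 3 (composite \<theta>)" for A
    proof -
      from A obtain l where l: "A \<subseteq> free l" by (rule multipoint_free[OF \<theta>(1)])
      with A show ?thesis using multipoint_composite_iff[OF \<theta>(1) l] reg(4)[of l] by blast
    qed
    moreover have "A \<in> multipoints u 3 (composite \<theta>)" if "A \<in> multipoints u 3 (strand \<theta> i)" for A
      using multipoint_composite_iff[OF \<theta>(1) singular_free(3)[OF that]] that by simp
    ultimately show "multipoints u 3 (composite \<theta>) = multipoints u 3 (\<Gamma> i (\<theta> i))"
      unfolding s by (intro set_eqI iffI)
    show "\<forall>\<^sub>F x in nhds s. composite \<theta> x = \<Gamma> i (\<theta> i) x" if "s \<in> A" for s
      using eventually_composite_eq_strand[OF \<theta>(1), of s i] free that unfolding s by blast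
  qed
qed

lemma single_crossing_composite:
  assumes i: "i \<in> {1..k}" and \<theta>: "range \<theta> \<subseteq> {0, 1}"
    and M: "\<And>t. t \<in> {0..1} \<Longrightarrow> M t = composite (\<theta>(i := t))"
  shows "single_crossing u (\<tau> i) M"
proof -
  have "range \<theta> \<subseteq> {0..1}" using \<theta> by (rule order_trans) auto
  note times = range_upd[OF this]
  from system(5)[OF i] obtain t where t: "t \<in> {0<..<1}" "crosses_wall u (\<tau> i) (\<Gamma> i) t"
    "\<And>r. r \<in> {0..1} - {t} \<Longrightarrow> regular_projection u (\<Gamma> i r)"
    unfolding single_crossing_def by blast
  then have t01: "t \<in> {0..1}" by simp
  have wall: "on_wall u (\<tau> i) A (M t)" "A \<subseteq> free i" if "on_wall u (\<tau> i) A (\<Gamma> i t)" for A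
  proof -
    have "(\<theta>(i := t)) j \<in> {0, 1}" if "j \<noteq> i" for j
      using subsetD[OF \<theta>, of "\<theta> j"] that by simp
    from on_wall_composite[where \<theta> = "\<theta>(i := t)", OF times[OF t01] this i] that M[OF t01]
    show "on_wall u (\<tau> i) A (M t)" "A \<subseteq> free i" by (simp_all del: insert_iff)
  qed
  have "crosses_wall u (\<tau> i) M t"
  proof (rule crosses_wall_transfer[where f = M and g = "\<Gamma> i", OF t(2) wall(1)])
    fix A s assume "on_wall u (\<tau> i) A (\<Gamma> i t)" "s \<in> A"
    then have "s \<in> free i" using wall(2) by blast
    moreover have "M t' s' = \<Gamma> i t' s'" if "t' \<in> {0<..<1}" "s' \<in> free i" for t' s'
    proof -
      have "t' \<in> {0..1}" using that(1) by simp
      from composite_eq_strand[OF times[OF this] that(2)] M[OF this] i show ?thesis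
        unfolding strand_def by simp
    qed
    ultimately show "\<exists>S T. open S \<and> t \<in> S \<and> open T \<and> s \<in> T \<and> (\<forall>t'\<in>S. \<forall>s'\<in>T. M t' s' = \<Gamma> i t' s')"
      \<comment> \<open>The crossing time is interior, so the open unit interval is a time
        neighbourhood on which the movie is known to be \<open>composite\<close>; in the parameter,
        \<open>free i\<close> is a neighbourhood on which it equals
        \<open>\<Gamma> i\<close>.\<close>
      using t(1) open_free by (intro exI[of _ "{0<..<1}"] exI[of _ "free i"]) auto
  qed
  moreover have "regular_projection u (M r)" if r: "r \<in> {0..1} - {t}" for r
  proof -
    have "regular_projection u (strand (\<theta>(i := r)) l)" for l
    proof (cases "l = i")
      case True
      then show ?thesis using t(3)[OF r] i unfolding strand_def by simp
    next
      case False
      have "\<theta> l \<in> {0, 1}" using \<theta> by blast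
      with False show ?thesis by (intro regular_strand) simp
    qed
    then show ?thesis using regular_composite[OF times] r M by simp
  qed
  ultimately show ?thesis unfolding single_crossing_def using t(1) by blast
qed

section \<open>Vertices and edges of the cube as composite curves\<close>

definition performed :: "nat set \<Rightarrow> nat \<Rightarrow> real" where
  "performed S = (\<lambda>j. if j \<in> S then 1 else 0)"

lemma performed_times: "performed S j \<in> {0, 1}" "range (performed S) \<subseteq> {0, 1}" "range (performed S) \<subseteq> {0..1}"
  unfolding performed_def by auto

lemma performed_insert: "performed (insert i S) = (performed S)(i := 1)"
  unfolding performed_def by auto

lemma composite_state_eq:
  assumes "S \<subseteq> {1..k}"
  shows "composite_state \<gamma>\<^sub>0 \<Gamma> B S = composite (performed S)"
proof
  fix s
  note eq = composite_eq_strand[OF performed_times(3), of s]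
  show "composite_state \<gamma>\<^sub>0 \<Gamma> B S s = composite (performed S) s"
  proof (cases "\<exists>i\<in>S. \<gamma>\<^sub>0 s \<in> B i")
    case True
    then obtain i where i: "i \<in> S" "\<gamma>\<^sub>0 s \<in> B i" by blast
    then have "(THE i. i \<in> S \<and> \<gamma>\<^sub>0 s \<in> B i) = i"
      using assms by (intro the_equality) (meson balls_disjoint subsetD)+
    then show ?thesis
      using True i assms eq[OF free_ball[of i s]] unfolding composite_state_def strand_def performed_def by auto
  next
    case False
    obtain l where "s \<in> free l" by (rule free_cover)
    \<comment> \<open>Either \<open>l\<close> is no move, or it is not in \<open>S\<close> and
      stands at time 0, or it is in \<open>S\<close> and \<open>\<gamma>\<^sub>0 s\<close> lies
      outside its ball.\<close>
    moreover have "strand (performed S) l s = \<gamma>\<^sub>0 s"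
      using False system(4)[of l] system(6)[of l 1 s] unfolding strand_def performed_def by auto
    ultimately show ?thesis using False eq unfolding composite_state_def by auto
  qed
qed

lemma composite_movie_eq:
  assumes "S \<subseteq> {1..k}" "i \<in> {1..k}" "t \<in> {0..1}"
  shows "composite_movie \<gamma>\<^sub>0 \<Gamma> B S i t = composite ((performed S)(i := t))"
proof
  fix s
  note times = range_upd[OF performed_times(3) assms(3)]
  show "composite_movie \<gamma>\<^sub>0 \<Gamma> B S i t s = composite ((performed S)(i := t)) s"
  proof (cases "\<gamma>\<^sub>0 s \<in> B i")
    case True
    then show ?thesis
      using composite_eq_strand[OF times free_ball[OF assms(2) True]] assms(2)
      unfolding composite_movie_def strand_def by simp
  next
    case False
    \<comment> \<open>Outside \<open>B i\<close> the composite movie is defined by the state in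
      which move \<open>i\<close> is complete, so time 1 stands where \<open>t\<close> is wanted;
      stationarity makes the two equal.\<close>
    then have "\<Gamma> i t s = \<Gamma> i 1 s" using system(6)[OF assms(2), where s = s] assms(3) by simp
    with False show ?thesis
      using composite_state_eq[of "insert i S"] assms(1,2)
        composite_update[OF assms(2), of "performed S" t s] composite_update[OF assms(2), of "performed S" 1 s]
      unfolding composite_movie_def performed_insert by simp
  qed
qed

end

section \<open>Visibility of the cube and its coherent lift\<close>

theorem theorem7p14:
  fixes u :: "real^3" and K :: "(real^3) set set" and \<gamma>\<^sub>0 :: curve and k :: nat
    and \<Gamma> :: "nat \<Rightarrow> movie" and B :: "nat \<Rightarrow> (real^3) set" and \<tau> :: "nat \<Rightarrow> wall"
  defines "\<Lambda> \<equiv> cube_level \<gamma>\<^sub>0 k \<Gamma>"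
    and "\<gamma> \<equiv> composite_state \<gamma>\<^sub>0 \<Gamma> B"
    and "M \<equiv> composite_movie \<gamma>\<^sub>0 \<Gamma> B"
  assumes "norm u = 1" and "knot_type K"
    and "C11_embedding \<gamma>\<^sub>0" and "range \<gamma>\<^sub>0 \<in> K" and "1 \<le> thickness \<gamma>\<^sub>0"
    and "regular_projection u \<gamma>\<^sub>0"
    and "separated_system u K \<gamma>\<^sub>0 k \<Gamma> B \<tau>"
  shows
    \<comment> \<open>composite states and intermediate composite curves\<close>
    "(\<forall>S\<subseteq>{1..k}. C11_embedding (\<gamma> S) \<and> range (\<gamma> S) \<in> K \<and> 1 \<le> thickness (\<gamma> S)
         \<and> len (\<gamma> S) \<le> \<Lambda> \<and> rop (\<gamma> S) \<le> \<Lambda> \<and> regular_projection u (\<gamma> S))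
     \<and> (\<forall>S\<subseteq>{1..k}. \<forall>i\<in>{1..k} - S. \<forall>t\<in>{0..1}.
         C11_embedding (M S i t) \<and> range (M S i t) \<in> K \<and> 1 \<le> thickness (M S i t)
         \<and> len (M S i t) \<le> \<Lambda> \<and> rop (M S i t) \<le> \<Lambda>)
     \<comment> \<open>composite movies\<close>
     \<and> (\<forall>S\<subseteq>{1..k}. \<forall>i\<in>{1..k} - S. M S i 0 = \<gamma> S \<and> M S i 1 = \<gamma> (insert i S)
         \<and> level_admissible_movie \<Lambda> K (M S i)
         \<and> (\<forall>t\<in>{0..1}. sim_class u (range (M S i t)) \<in> sublevel_space \<Lambda> u K)
         \<and> projection_generic u (M S i) \<and> single_crossing u (\<tau> i) (M S i))
     \<comment> \<open>visibility of the diagrams and transitions\<close>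
     \<and> (\<forall>S\<subseteq>{1..k}. diagram u (\<gamma> S) \<in> verts (visible_graph \<Lambda> u K))
     \<and> (\<forall>S\<subseteq>{1..k}. \<forall>i\<in>{1..k} - S.
         let e = arc_of u (M S i) in
         e \<in> arcs (visible_graph \<Lambda> u K) \<and> e \<in> reidemeister_arcs u K (\<tau> i)
         \<and> tail (visible_graph \<Lambda> u K) e = diagram u (\<gamma> S)
         \<and> head (visible_graph \<Lambda> u K) e = diagram u (\<gamma> (insert i S)))
     \<comment> \<open>the vertex-coherent lift of the cube\<close>
     \<and> (inj_on (\<lambda>S. diagram u (\<gamma> S)) (Pow {1..k}) \<longrightarrow>
         (\<exists>F. vertex_coherent_lift \<Lambda> u K (cube u K \<gamma>\<^sub>0 k \<Gamma> B) F
            \<and> (\<forall>S\<subseteq>{1..k}. sim_class u (range (\<gamma> S)) \<in> F (diagram u (\<gamma> S)))))"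
proof -
  interpret separated_moves u K \<gamma>\<^sub>0 k \<Gamma> B \<tau> by unfold_locales fact+
  note times = range_upd[OF performed_times(3)]
  have \<gamma>: "\<gamma> S = composite (performed S)" if "S \<subseteq> {1..k}" for S
    unfolding \<gamma>_def using composite_state_eq[OF that] .
  have M: "M S i t = composite ((performed S)(i := t))" if "S \<subseteq> {1..k}" "i \<in> {1..k} - S" "t \<in> {0..1}" for S i t
    unfolding M_def using composite_movie_eq[of S i t] that by simp
  have state: "C11_embedding (\<gamma> S)" "range (\<gamma> S) \<in> K" "1 \<le> thickness (\<gamma> S)" "len (\<gamma> S) \<le> \<Lambda>" "rop (\<gamma> S) \<le> \<Lambda>"
    "regular_projection u (\<gamma> S)" "\<gamma> S \<in> embeddings K" if "S \<subseteq> {1..k}" for S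
    unfolding \<gamma>[OF that] \<Lambda>_def
    by (intro composite_embedding range_composite composite_thickness len_composite_le composite_level
        regular_composite regular_strand performed_times)+
  have slice: "C11_embedding (M S i t)" "range (M S i t) \<in> K" "1 \<le> thickness (M S i t)" "len (M S i t) \<le> \<Lambda>"
    "rop (M S i t) \<le> \<Lambda>" "M S i t \<in> embeddings K"
    if "S \<subseteq> {1..k}" "i \<in> {1..k} - S" "t \<in> {0..1}" for S i t
    unfolding M[OF that] \<Lambda>_def
    by (intro composite_embedding range_composite composite_thickness len_composite_le composite_level
        times that(3))+
  have ends: "M S i 0 = \<gamma> S" "M S i 1 = \<gamma> (insert i S)" if "S \<subseteq> {1..k}" "i \<in> {1..k} - S" for S i
  proof -
    have "(performed S)(i := 0) = performed S" using that(2) unfolding performed_def by auto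
    then show "M S i 0 = \<gamma> S" using M[OF that] \<gamma>[OF that(1)] by simp
    have "insert i S \<subseteq> {1..k}" using that by auto
    from \<gamma>[OF this] show "M S i 1 = \<gamma> (insert i S)" using M[OF that] by (simp add: performed_insert)
  qed
  have admissible: "level_admissible_movie \<Lambda> K (M S i)" and crossing: "single_crossing u (\<tau> i) (M S i)"
    if "S \<subseteq> {1..k}" "i \<in> {1..k} - S" for S i
    using composite_movie_admissible[of i "performed S" "M S i"] single_crossing_composite[of i "performed S" "M S i"]
      performed_times that M[OF that] unfolding \<Lambda>_def by auto
  note generic = single_crossing_projection_generic[OF crossing]
  have sub: "sim_class u (range (M S i t)) \<in> sublevel_space \<Lambda> u K"
    if "S \<subseteq> {1..k}" "i \<in> {1..k} - S" "t \<in> {0..1}" for S i t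
    using slice[OF that] unfolding sublevel_space_def sublevel_curves_def by blast

  let ?D = "\<lambda>S. diagram u (\<gamma> S)" and ?x = "\<lambda>S. sim_class u (range (\<gamma> S))"
  let ?T = "\<lambda>S. fiber_topology \<Lambda> u K (?D S)"
  \<comment> \<open>The component depends on the state only and not on an edge. Every edge at
    \<open>S\<close> is lifted by a movie starting or ending exactly at \<open>\<gamma> S\<close>,
    which is why the choices are coherent.\<close>
  define C where "C = (\<lambda>S. path_component_of_set (?T S) (?x S))"
  have C: "C S \<in> path_components_of (?T S)" "?x S \<in> C S" if S: "S \<subseteq> {1..k}" for S
  proof -
    have "?x S \<in> sublevel_space \<Lambda> u K"
      using state[OF S] unfolding sublevel_space_def sublevel_curves_def by blast
    then have "?x S \<in> fiber \<Lambda> u K (?D S)"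
      unfolding fiber_def using state[OF S] sim_class_refl by blast
    then have x: "?x S \<in> topspace (?T S)"
      unfolding fiber_topology_def topspace_subtopology topspace_sublevel_topology fiber_def by blast
    then show "C S \<in> path_components_of (?T S)" unfolding C_def path_components_of_def by blast
    show "?x S \<in> C S" unfolding C_def using x by (simp add: path_component_of_refl)
  qed
  have vertex: "?D S \<in> verts (G_S u K)" "(?D S, C S) \<in> verts (lift_graph \<Lambda> u K)" if S: "S \<subseteq> {1..k}" for S
  proof -
    show "?D S \<in> verts (G_S u K)" unfolding G_S_def using state[OF S] by auto
    then show "(?D S, C S) \<in> verts (lift_graph \<Lambda> u K)" unfolding lift_graph_def using C[OF S] by simp
  qed
  have arc: "tail (G_S u K) (arc_of u (M S i)) = ?D S" "head (G_S u K) (arc_of u (M S i)) = ?D (insert i S)"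
    "arc_of u (M S i) \<in> reidemeister_arcs u K (\<tau> i)" "arc_of u (M S i) \<in> arcs (G_S u K)"
    "(arc_of u (M S i), C S, C (insert i S)) \<in> arcs (lift_graph \<Lambda> u K)"
    if S: "S \<subseteq> {1..k}" "i \<in> {1..k} - S" for S i
  proof -
    let ?e = "arc_of u (M S i)"
    have S': "insert i S \<subseteq> {1..k}" using S by auto
    show t: "tail (G_S u K) ?e = ?D S" and h: "head (G_S u K) ?e = ?D (insert i S)"
      unfolding G_S_def arc_of_def using ends[OF S] by simp_all
    have adm: "admissible_movie K (M S i)" using admissible[OF S] unfolding level_admissible_movie_def by simp
    then show "?e \<in> reidemeister_arcs u K (\<tau> i)" unfolding reidemeister_arcs_def using crossing[OF S] by blast
    then show e: "?e \<in> arcs (G_S u K)" unfolding G_S_def by auto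
    have "realizes u (M S i) ?e" unfolding realizes_def using crossing[OF S] by blast
    then show "(?e, C S, C (insert i S)) \<in> arcs (lift_graph \<Lambda> u K)"
      unfolding lift_graph_def using e C[OF S(1)] C[OF S'] admissible[OF S] generic[OF S] ends[OF S]
      by (simp add: t h) metis
  qed
  have visible: "?D S \<in> verts (visible_graph \<Lambda> u K)" if "S \<subseteq> {1..k}" for S
    using vertex(2)[OF that] unfolding visible_graph_def by force
  have transition: "let e = arc_of u (M S i) in
         e \<in> arcs (visible_graph \<Lambda> u K) \<and> e \<in> reidemeister_arcs u K (\<tau> i)
         \<and> tail (visible_graph \<Lambda> u K) e = diagram u (\<gamma> S)
         \<and> head (visible_graph \<Lambda> u K) e = diagram u (\<gamma> (insert i S))"
    if "S \<subseteq> {1..k}" "i \<in> {1..k} - S" for S i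
    using arc[OF that] unfolding visible_graph_def Let_def by force

  let ?Q = "cube u K \<gamma>\<^sub>0 k \<Gamma> B"
  have Q: "verts ?Q = ?D ` Pow {1..k}" "arcs ?Q = {arc_of u (M S i) | S i. S \<subseteq> {1..k} \<and> i \<in> {1..k} - S}"
    "tail ?Q = tail (G_S u K)" "head ?Q = head (G_S u K)"
    unfolding cube_def \<gamma>_def M_def by simp_all
  have lift: "\<exists>F. vertex_coherent_lift \<Lambda> u K ?Q F \<and> (\<forall>S\<subseteq>{1..k}. ?x S \<in> F (?D S))"
    if inj: "inj_on ?D (Pow {1..k})"
  proof -
    \<comment> \<open>A lift assigns components to diagrams, whereas \<open>C\<close> is indexed by
      subsets. Distinctness of the diagrams allows the subset to be recovered from its
      diagram.\<close>
    define F where "F = (\<lambda>D. C (the_inv_into (Pow {1..k}) ?D D))"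
    have F: "F (?D S) = C S" if "S \<subseteq> {1..k}" for S
      unfolding F_def using the_inv_into_f_f[OF inj] that by simp
    have "wf_digraph ?Q"
    proof
      fix e assume "e \<in> arcs ?Q"
      then obtain S i where S: "S \<subseteq> {1..k}" "i \<in> {1..k} - S" "e = arc_of u (M S i)" unfolding Q by blast
      then have "insert i S \<subseteq> {1..k}" by auto
      then show "tail ?Q e \<in> verts ?Q" "head ?Q e \<in> verts ?Q" using S arc[OF S(1,2)] unfolding Q by auto
    qed
    then have "subgraph ?Q (G_S u K)"
      unfolding subgraph_def compatible_def using wf_digraph_G_S vertex(1) arc(4) unfolding Q by auto
    moreover have "arcs ?Q \<subseteq> (\<lambda>(S, i). arc_of u (M S i)) ` (Pow {1..k} \<times> {1..k})"
    proof
      fix e assume "e \<in> arcs ?Q"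
      then obtain S i where "S \<subseteq> {1..k}" "i \<in> {1..k} - S" "e = arc_of u (M S i)" unfolding Q by blast
      then show "e \<in> (\<lambda>(S, i). arc_of u (M S i)) ` (Pow {1..k} \<times> {1..k})"
        by (intro image_eqI[of _ _ "(S, i)"]) auto
    qed
    then have "finite (arcs ?Q)" by (rule finite_subset) auto
    moreover have "finite (verts ?Q)" unfolding Q by simp
    moreover have "(D, F D) \<in> verts (lift_graph \<Lambda> u K)" if "D \<in> verts ?Q" for D
      using that vertex(2) F unfolding Q by auto
    moreover have "(e, F (tail ?Q e), F (head ?Q e)) \<in> arcs (lift_graph \<Lambda> u K)" if "e \<in> arcs ?Q" for e
    proof -
      from that obtain S i where S: "S \<subseteq> {1..k}" "i \<in> {1..k} - S" "e = arc_of u (M S i)" unfolding Q by blast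
      then have "insert i S \<subseteq> {1..k}" by auto
      then show ?thesis using S arc[OF S(1,2)] F unfolding Q by simp
    qed
    ultimately have "vertex_coherent_lift \<Lambda> u K ?Q F" unfolding vertex_coherent_lift_def by blast
    then show ?thesis using F C(2) by auto
  qed
  show ?thesis
    by (intro conjI allI impI ballI state slice ends admissible sub generic crossing visible transition lift)
qed

end
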